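(* There exists a family $\mathfrak{G}$ of finite nilpotent groups, of unbounded nilpotency class (that is, for every natural number $n$ some member of $\mathfrak{G}$ has nilpotency class at least $n$), such that every member $G$ of $\mathfrak{G}$ satisfies the following conditions: (1) $G$ admits a metacyclic Frobenius group $FH$ of automorphisms, with kernel $F$ and complement $H$; (2) the centralizer $C_G(F)$ of the kernel in $G$ is trivial; (3) the centralizer $C_G(H)$ of the complement in $G$ is abelian.
   Context: A finite Frobenius group $FH$ with kernel $F$ and complement $H$ is a semidirect product of a normal subgroup $F$ by $H$ such that $C_F(h)=1$ for every non-trivial element $h$ of $H$ (with $F$ and $H$ non-trivial). A group is metacyclic if it has a cyclic normal subgroup with cyclic quotient. For a group $A$ acting by automorphisms on a group $G$, the centralizer $C_G(A)$ is the fixed-point subgroup $\{g\in G : g^\alpha=g \text{ for all } \alpha\in A\}$. *)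

theory Defs
  imports "HOL-Algebra.Bij" "HOL-Algebra.Elementary_Groups"
begin

definition commutator_subgroup :: "('a, 'b) monoid_scheme \<Rightarrow> 'a set \<Rightarrow> 'a set \<Rightarrow> 'a set"
  where "commutator_subgroup G H K =
    generate G (\<Union>h\<in>H. \<Union>k\<in>K. {h \<otimes>\<^bsub>G\<^esub> k \<otimes>\<^bsub>G\<^esub> inv\<^bsub>G\<^esub> h \<otimes>\<^bsub>G\<^esub> inv\<^bsub>G\<^esub> k})"

text \<open>The series is indexed from 0: \<open>lower_central G n\<close> is the term usually written
  \<open>\<gamma>\<close> with index \<open>n + 1\<close>.\<close>

primrec lower_central :: "('a, 'b) monoid_scheme \<Rightarrow> nat \<Rightarrow> 'a set"
  where
    "lower_central G 0 = carrier G"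
  | "lower_central G (Suc n) = commutator_subgroup G (lower_central G n) (carrier G)"

definition nilpotent_group :: "('a, 'b) monoid_scheme \<Rightarrow> bool"
  where "nilpotent_group G \<longleftrightarrow> group G \<and> (\<exists>n. lower_central G n = {\<one>\<^bsub>G\<^esub>})"

text \<open>Only meaningful for nilpotent groups; the trivial group has class 0.\<close>

definition nilpotency_class :: "('a, 'b) monoid_scheme \<Rightarrow> nat"
  where "nilpotency_class G = (LEAST n. lower_central G n = {\<one>\<^bsub>G\<^esub>})"

definition metacyclic_group :: "('a, 'b) monoid_scheme \<Rightarrow> bool"
  where "metacyclic_group A \<longleftrightarrow>
    group A \<and> (\<exists>N. N \<lhd> A \<and> cyclic_group (A\<lparr>carrier := N\<rparr>) \<and> cyclic_group (A Mod N))"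

text \<open>\<open>A\<close> is the internal semidirect product of the kernel \<open>F\<close> by the complement \<open>H\<close>.\<close>

definition frobenius_group :: "('a, 'b) monoid_scheme \<Rightarrow> 'a set \<Rightarrow> 'a set \<Rightarrow> bool"
  where "frobenius_group A F H \<longleftrightarrow>
    group A \<and> finite (carrier A) \<and>
    F \<lhd> A \<and> subgroup H A \<and> F <#>\<^bsub>A\<^esub> H = carrier A \<and> F \<inter> H = {\<one>\<^bsub>A\<^esub>} \<and>
    F \<noteq> {\<one>\<^bsub>A\<^esub>} \<and> H \<noteq> {\<one>\<^bsub>A\<^esub>} \<and>
    (\<forall>h\<in>H - {\<one>\<^bsub>A\<^esub>}. {x \<in> F. x \<otimes>\<^bsub>A\<^esub> h = h \<otimes>\<^bsub>A\<^esub> x} = {\<one>\<^bsub>A\<^esub>})"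

definition fixed_points :: "('a, 'b) monoid_scheme \<Rightarrow> ('a \<Rightarrow> 'a) set \<Rightarrow> 'a set"
  where "fixed_points G A = {g \<in> carrier G. \<forall>\<alpha>\<in>A. \<alpha> g = g}"

end

theory Submission
  imports Defs
    "HOL-Algebra.Algebraic_Closure_Type"
    "HOL-Library.Function_Algebras"
    "HOL-Library.Z2"
    "HOL-Number_Theory.Residue_Primitive_Roots"
begin

text \<open>
  For a large prime \<open>p\<close> the affine group of the field with \<open>p\<close> elements is a metacyclic Frobenius group
  \<open>FH\<close>: \<open>F\<close> consists of the \<open>p\<close> translations and \<open>H\<close> of the \<open>p - 1\<close> multiplications. Let \<open>S\<close> be a finite
  field containing a primitive \<open>p\<close>-th root of unity \<open>\<omega>\<close>, and let \<open>A\<close> be the space of vectors over \<open>S\<close>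
  with coordinates \<open>1, \<dots>, p - 1\<close>. The generator of \<open>F\<close> multiplies the coordinate \<open>i\<close> by \<open>\<omega> ^ i\<close>, and \<open>H\<close>
  permutes the coordinates regularly. The group \<open>A\<close> acts by translations on functions \<open>P\<close> from \<open>A\<close> to \<open>S\<close>
  normalised by \<open>P 0 = 0\<close>, and for an \<open>FH\<close>-invariant and translation invariant space \<open>M\<close> of such functions
  of bounded degree \<open>FH\<close> acts on the semidirect product \<open>G\<close> of \<open>M\<close> by \<open>A\<close>. Up to sign and
  normalisation, the commutator of \<open>P\<close> with an element of \<open>A\<close> is a difference of \<open>P\<close>, which has smaller degree;
  so \<open>G\<close> is nilpotent, and its class is at least the largest degree that occurs in \<open>M\<close>.

  Two linear conditions are imposed on \<open>M\<close>. The first says that the sum of every normalised translate of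
  \<open>P\<close> over an orbit of \<open>F\<close> vanishes; as \<open>p\<close> is invertible in \<open>S\<close>, \<open>F\<close> then has no fixed points in \<open>M\<close>, and it has
  none in \<open>A\<close>. The fixed points of \<open>H\<close> in \<open>A\<close> are the constant vectors \<open>v\<close>. The second condition says
  that the sum over \<open>H\<close> of the twisted copies of \<open>P\<close> has zero second difference in every constant
  direction. If \<open>P\<close> is fixed by \<open>H\<close>, then the copies twisted by the translation \<open>1\<close> are the copies of \<open>P\<close>
  under the non-trivial elements of \<open>F\<close>, and by the first condition they add up to \<open>- P\<close>. Hence
  \<open>P (x + v) = P x + P v\<close>, so \<open>v\<close> acts trivially on \<open>P\<close>, and the fixed points of \<open>H\<close> in \<open>G\<close> commute
  (lemma \<open>H_fixed_commute\<close>).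

  It remains to find functions of degree \<open>n\<close> in \<open>M\<close>. For \<open>P = (\<Sum>t. f t * x (t 0) * \<dots> * x (t (n - 1)))\<close>, with
  \<open>t\<close> ranging over a box of index tuples whose partial sums stay below \<open>p\<close>, the first condition is automatic.
  The second follows if \<open>f\<close> has zero sum over the fibres of fewer than \<open>n * 2 ^ n\<close> maps, one for each choice
  of a non-empty set \<open>Y\<close> of positions and a position \<open>w\<close> outside \<open>Y\<close>: two tuples are in the same fibre if
  their \<open>Y\<close>-parts are proportional modulo \<open>p\<close>, they agree outside \<open>Y\<close> and \<open>w\<close>, and the sums over \<open>w\<close> and
  \<open>Y\<close> agree modulo \<open>p\<close> (lemma \<open>poly_of_complement_sum_zero\<close>). Each map has at most \<open>p ^ (n - 1)\<close> fibres, whereas the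
  number of tuples grows like a constant times \<open>p ^ n\<close>. For large \<open>p\<close> the pigeonhole principle gives
  \<open>f \<noteq> 0\<close> (lemma \<open>zero_fibre_sums_exist\<close>).
\<close>

hide_const (open) Divisibility.prime

section \<open>The affine group of a prime field as a Frobenius group\<close>

lemma mod_mult_cancel_nat:
  fixes p h :: nat
  assumes "prime p" "h \<in> {1..<p}"
  obtains g where "g \<in> {1..<p}" "(h * g) mod p = 1" "(g * h) mod p = 1"
proof -
  have p1: "p > 1" using assms prime_gt_1_nat by blast
  have "coprime h p"
    using assms by (metis atLeastLessThan_iff coprime_commute less_le_trans linorder_not_less
        nat_dvd_not_less not_gr_zero not_one_le_zero prime_imp_coprime)
  then obtain x where x: "[h * x = 1] (mod p)"
    using cong_solve_coprime_nat by auto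
  define g where "g = x mod p"
  have g: "(h * g) mod p = 1" using x p1 by (simp add: g_def cong_def mod_mult_right_eq)
  moreover have "g \<noteq> 0" using g p1 by (auto intro: gr0I)
  moreover have "g < p" using p1 by (simp add: g_def)
  ultimately show thesis using that[of g] by (simp add: mult.commute)
qed

lemma mult_mod_prime_range:
  fixes p h g :: nat
  assumes "prime p" "h \<in> {1..<p}" "g \<in> {1..<p}"
  shows "(h * g) mod p \<in> {1..<p}"
proof -
  have "\<not> p dvd h * g"
    using assms by (auto simp: prime_dvd_mult_iff dest: dvd_imp_le)
  then show ?thesis using assms by (auto simp: Suc_le_eq prime_gt_0_nat dvd_eq_mod_eq_0)
qed

text \<open>An action of the affine group of the integers modulo \<open>p\<close> by automorphisms of \<open>G\<close>. The pair
  \<open>(j, h)\<close>, with \<open>j < p\<close> and \<open>0 < h < p\<close>, stands for the affine map \<open>x \<mapsto> h * x + j\<close>; the translations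
  are the pairs \<open>(j, 1)\<close> and the multiplications the pairs \<open>(0, h)\<close>. The last clause is faithfulness.\<close>

definition affine_action :: "nat \<Rightarrow> ('a, 'b) monoid_scheme \<Rightarrow> (nat \<Rightarrow> nat \<Rightarrow> 'a \<Rightarrow> 'a) \<Rightarrow> bool"
  where "affine_action p G act \<longleftrightarrow>
    (\<forall>j<p. \<forall>h\<in>{1..<p}. act j h \<in> hom G G) \<and>
    (\<forall>x\<in>carrier G. act 0 1 x = x) \<and>
    (\<forall>j<p. \<forall>h\<in>{1..<p}. \<forall>k<p. \<forall>g\<in>{1..<p}. \<forall>x\<in>carrier G.
       act j h (act k g x) = act ((j + k * h) mod p) (h * g mod p) x) \<and>
    (\<forall>j<p. \<forall>h\<in>{1..<p}. (\<forall>x\<in>carrier G. act j h x = x) \<longrightarrow> j = 0 \<and> h = 1)"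

text \<open>A copy of the affine group of the integers modulo \<open>p\<close> inside a group, with \<open>\<tau> j h\<close> in the place of
  the affine map \<open>x \<mapsto> h * x + j\<close>.\<close>

locale affine_family = group \<Gamma> for \<Gamma> (structure) +
  fixes p :: nat and \<tau> :: "nat \<Rightarrow> nat \<Rightarrow> 'a"
  assumes prime_p: "prime p" and p_gt_2: "2 < p"
    and in_carrier: "\<And>j h. j < p \<Longrightarrow> h \<in> {1..<p} \<Longrightarrow> \<tau> j h \<in> carrier \<Gamma>"
    and tau_mult: "\<And>j h k g. j < p \<Longrightarrow> h \<in> {1..<p} \<Longrightarrow> k < p \<Longrightarrow> g \<in> {1..<p} \<Longrightarrow>
       \<tau> j h \<otimes> \<tau> k g = \<tau> ((j + k * h) mod p) (h * g mod p)"
    and tau_inj: "\<And>j h k g. j < p \<Longrightarrow> h \<in> {1..<p} \<Longrightarrow> k < p \<Longrightarrow> g \<in> {1..<p} \<Longrightarrow>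
       \<tau> j h = \<tau> k g \<Longrightarrow> j = k \<and> h = g"
begin

text \<open>The copies of the whole affine group, of its translations and of its multiplications.\<close>

definition "AA = {\<tau> j h | j h. j < p \<and> h \<in> {1..<p}}"
definition "FF = {\<tau> j 1 | j. j < p}"
definition "HH = {\<tau> 0 h | h. h \<in> {1..<p}}"

abbreviation "\<Lambda> \<equiv> \<Gamma>\<lparr>carrier := AA\<rparr>"

lemma p_pos [simp]: "0 < p" "1 < p" "Suc 0 < p" "p \<noteq> Suc 0" using p_gt_2 by auto

lemma AA_I: "j < p \<Longrightarrow> h \<in> {1..<p} \<Longrightarrow> \<tau> j h \<in> AA"
  unfolding AA_def by blast

lemma tau_one: "\<tau> 0 1 = \<one>"
proof -
  have "\<tau> 0 1 \<otimes> \<tau> 0 1 = \<tau> 0 1" by (subst tau_mult) auto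
  moreover have "\<tau> 0 1 \<in> carrier \<Gamma>" by (rule in_carrier) auto
  ultimately show ?thesis using l_cancel_one by blast
qed

lemma tau_inverse:
  assumes "j < p" "h \<in> {1..<p}"
  shows "\<exists>k g. k < p \<and> g \<in> {1..<p} \<and> inv \<tau> j h = \<tau> k g \<and> (h = 1 \<longrightarrow> g = 1) \<and> (j = 0 \<longrightarrow> k = 0) \<and>
    \<tau> k g \<otimes> \<tau> j h = \<one>"
proof -
  obtain g where g: "g \<in> {1..<p}" "(h * g) mod p = 1" "(g * h) mod p = 1"
    using mod_mult_cancel_nat[OF prime_p assms(2)] by blast
  define k where "k = (p - j) * g mod p"
  have k: "k < p" by (simp add: k_def)
  have "(k + j * g) mod p = ((p - j) * g + j * g) mod p"
    by (simp add: k_def mod_add_left_eq)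
  also have "(p - j) * g + j * g = p * g"
    using assms(1) by (simp flip: add_mult_distrib)
  finally have k0: "(k + j * g) mod p = 0" by simp
  have e: "\<tau> k g \<otimes> \<tau> j h = \<one>"
    using assms g k k0 by (simp add: tau_mult tau_one[simplified])
  then have "inv \<tau> j h = \<tau> k g"
    using in_carrier assms g k by (intro inv_equality) auto
  moreover have "h = 1 \<Longrightarrow> g = 1" using g by auto
  moreover have "j = 0 \<Longrightarrow> k = 0" by (simp add: k_def)
  ultimately show ?thesis using g k e by blast
qed

lemma mult_range: "h \<in> {1..<p} \<Longrightarrow> g \<in> {1..<p} \<Longrightarrow> h * g mod p \<in> {1..<p}"
  using mult_mod_prime_range[OF prime_p] .

lemma subgroup_AA: "subgroup AA \<Gamma>"
proof (rule subgroupI)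
  show "AA \<subseteq> carrier \<Gamma>" using in_carrier by (auto simp: AA_def)
  show "AA \<noteq> {}" unfolding AA_def using p_pos by fastforce
next
  fix a assume "a \<in> AA"
  then obtain j h where a: "a = \<tau> j h" "j < p" "h \<in> {1..<p}" by (auto simp: AA_def)
  obtain k g where "k < p" "g \<in> {1..<p}" "inv \<tau> j h = \<tau> k g" using tau_inverse[OF a(2,3)] by blast
  then show "inv a \<in> AA" unfolding AA_def a by blast
next
  fix a b assume "a \<in> AA" "b \<in> AA"
  then obtain j h k g where ab: "a = \<tau> j h" "j < p" "h \<in> {1..<p}" "b = \<tau> k g" "k < p" "g \<in> {1..<p}"
    by (auto simp: AA_def)
  have "a \<otimes> b = \<tau> ((j + k * h) mod p) (h * g mod p)" using ab tau_mult by auto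
  moreover have "(j + k * h) mod p < p" "h * g mod p \<in> {1..<p}" using mult_range ab by auto
  ultimately show "a \<otimes> b \<in> AA" unfolding AA_def by blast
qed

lemma group_Lambda: "group \<Lambda>"
  using subgroup_AA subgroup.subgroup_is_group group_axioms by blast

lemma tau_1_mult:
  "j < p \<Longrightarrow> k < p \<Longrightarrow> \<tau> j 1 \<otimes> \<tau> k 1 = \<tau> ((j + k) mod p) 1"
  by (subst tau_mult) auto

lemma tau_0_mult:
  "h \<in> {1..<p} \<Longrightarrow> g \<in> {1..<p} \<Longrightarrow> \<tau> 0 h \<otimes> \<tau> 0 g = \<tau> 0 (h * g mod p)"
  by (subst tau_mult) auto

lemma tau_split: "j < p \<Longrightarrow> h \<in> {1..<p} \<Longrightarrow> \<tau> j h = \<tau> j 1 \<otimes> \<tau> 0 h"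
  by (subst tau_mult) auto

lemma inv_Lambda: "x \<in> AA \<Longrightarrow> inv\<^bsub>\<Lambda>\<^esub> x = inv x"
  using subgroup_AA m_inv_consistent by simp

lemma subgroup_FF: "subgroup FF \<Lambda>"
proof (rule group.subgroupI[OF group_Lambda])
  show s: "FF \<subseteq> carrier \<Lambda>" by (auto simp: FF_def intro!: AA_I)
  show "FF \<noteq> {}" unfolding FF_def using p_pos by blast
next
  fix a assume a0: "a \<in> FF"
  then obtain j where a: "a = \<tau> j 1" "j < p" by (auto simp: FF_def)
  obtain k g where "k < p" "inv \<tau> j 1 = \<tau> k g" "g = 1" using tau_inverse[OF a(2), of 1] p_pos by auto
  moreover have "a \<in> AA" using a by (auto intro!: AA_I)
  ultimately show "inv\<^bsub>\<Lambda>\<^esub> a \<in> FF" unfolding FF_def using a inv_Lambda by auto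
next
  fix a b assume "a \<in> FF" "b \<in> FF"
  then show "a \<otimes>\<^bsub>\<Lambda>\<^esub> b \<in> FF" unfolding FF_def using tau_1_mult by fastforce
qed

lemma subgroup_HH: "subgroup HH \<Lambda>"
proof (rule group.subgroupI[OF group_Lambda])
  show s: "HH \<subseteq> carrier \<Lambda>" by (auto simp: HH_def intro!: AA_I)
  show "HH \<noteq> {}" unfolding HH_def using p_pos by fastforce
next
  fix a assume a0: "a \<in> HH"
  then obtain h where a: "a = \<tau> 0 h" "h \<in> {1..<p}" by (auto simp: HH_def)
  obtain k g where "inv \<tau> 0 h = \<tau> k g" "k = 0" "g \<in> {1..<p}"
    using tau_inverse[of 0 h] a p_pos by blast
  moreover have "a \<in> AA" using a by (auto intro!: AA_I)
  ultimately show "inv\<^bsub>\<Lambda>\<^esub> a \<in> HH" unfolding HH_def using a inv_Lambda by auto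
next
  fix a b assume "a \<in> HH" "b \<in> HH"
  then obtain h g where ab: "a = \<tau> 0 h" "h \<in> {1..<p}" "b = \<tau> 0 g" "g \<in> {1..<p}" by (auto simp: HH_def)
  then show "a \<otimes>\<^bsub>\<Lambda>\<^esub> b \<in> HH" unfolding HH_def using tau_0_mult mult_range by auto
qed

lemma normal_FF: "FF \<lhd> \<Lambda>"
  unfolding group.normal_inv_iff[OF group_Lambda]
proof (intro conjI ballI subgroup_FF)
  fix x f assume "x \<in> carrier \<Lambda>" and f0: "f \<in> FF"
  then obtain j h where x: "x = \<tau> j h" "j < p" "h \<in> {1..<p}" by (auto simp: AA_def)
  obtain i where f: "f = \<tau> i 1" "i < p" using f0 by (auto simp: FF_def)
  obtain k g where kg: "k < p" "g \<in> {1..<p}" "inv \<tau> j h = \<tau> k g" "\<tau> k g \<otimes> \<tau> j h = \<one>"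
    using tau_inverse[OF x(2,3)] by blast
  have "\<tau> ((k + j * g) mod p) (g * h mod p) = \<tau> 0 1"
    using kg x tau_mult[of k g j h] tau_one by auto
  then have gh: "g * h mod p = 1"
    using tau_inj[of "(k + j * g) mod p" "g * h mod p" 0 1] mult_range kg x by auto
  have xf: "x \<otimes> f = \<tau> ((j + i * h) mod p) h" using x f by (simp add: tau_mult)
  have "x \<otimes> f \<otimes> \<tau> k g = \<tau> (((j + i * h) mod p + k * h) mod p) 1"
    unfolding xf using x kg gh by (subst tau_mult) (auto simp: mult.commute)
  then have "x \<otimes> f \<otimes> \<tau> k g \<in> FF" unfolding FF_def by auto
  moreover have "x \<in> AA" using x by (auto intro!: AA_I)
  ultimately show "x \<otimes>\<^bsub>\<Lambda>\<^esub> f \<otimes>\<^bsub>\<Lambda>\<^esub> inv\<^bsub>\<Lambda>\<^esub> x \<in> FF"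
    using inv_Lambda kg x by simp
qed

lemma frobenius_Lambda: "frobenius_group \<Lambda> FF HH"
  unfolding frobenius_group_def
proof (intro conjI group_Lambda normal_FF subgroup_HH)
  have "AA \<subseteq> (\<lambda>(j,h). \<tau> j h) ` ({..<p} \<times> {1..<p})" by (force simp: AA_def)
  then show "finite (carrier \<Lambda>)" by (simp add: finite_subset)
  show "FF <#>\<^bsub>\<Lambda>\<^esub> HH = carrier \<Lambda>"
  proof
    show "FF <#>\<^bsub>\<Lambda>\<^esub> HH \<subseteq> carrier \<Lambda>"
      using group.setmult_subset_G[OF group_Lambda, of FF HH]
        subgroup.subset[OF subgroup_FF] subgroup.subset[OF subgroup_HH] by blast
    show "carrier \<Lambda> \<subseteq> FF <#>\<^bsub>\<Lambda>\<^esub> HH"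
    proof
      fix x assume "x \<in> carrier \<Lambda>"
      then obtain j h where x: "x = \<tau> j h" "j < p" "h \<in> {1..<p}" by (auto simp: AA_def)
      have "\<tau> j 1 \<in> FF" "\<tau> 0 h \<in> HH" using x by (auto simp: FF_def HH_def)
      then show "x \<in> FF <#>\<^bsub>\<Lambda>\<^esub> HH" using tau_split[OF x(2,3)] x by (auto simp: set_mult_def)
    qed
  qed
  show "FF \<inter> HH = {\<one>\<^bsub>\<Lambda>\<^esub>}"
  proof
    show "FF \<inter> HH \<subseteq> {\<one>\<^bsub>\<Lambda>\<^esub>}"
      using tau_inj tau_one unfolding FF_def HH_def by fastforce
    show "{\<one>\<^bsub>\<Lambda>\<^esub>} \<subseteq> FF \<inter> HH"
      using subgroup.one_closed[OF subgroup_FF] subgroup.one_closed[OF subgroup_HH] by simp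
  qed
  show "FF \<noteq> {\<one>\<^bsub>\<Lambda>\<^esub>}"
  proof
    assume "FF = {\<one>\<^bsub>\<Lambda>\<^esub>}"
    moreover have "\<tau> 1 1 \<in> FF" unfolding FF_def by auto
    ultimately have "\<tau> 1 1 = \<tau> 0 1" using tau_one by simp
    then show False using tau_inj[of 1 1 0 1] by auto
  qed
  show "HH \<noteq> {\<one>\<^bsub>\<Lambda>\<^esub>}"
  proof
    assume "HH = {\<one>\<^bsub>\<Lambda>\<^esub>}"
    moreover have "\<tau> 0 2 \<in> HH" unfolding HH_def using p_gt_2 by auto
    ultimately have "\<tau> 0 2 = \<tau> 0 1" using tau_one by simp
    then show False using tau_inj[of 0 2 0 1] p_gt_2 by auto
  qed
  show "\<forall>h\<in>HH - {\<one>\<^bsub>\<Lambda>\<^esub>}. {x \<in> FF. x \<otimes>\<^bsub>\<Lambda>\<^esub> h = h \<otimes>\<^bsub>\<Lambda>\<^esub> x} = {\<one>\<^bsub>\<Lambda>\<^esub>}"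
  proof
    fix y assume y0: "y \<in> HH - {\<one>\<^bsub>\<Lambda>\<^esub>}"
    then obtain h where y: "y = \<tau> 0 h" "h \<in> {1..<p}" "h \<noteq> 1"
      using tau_one unfolding HH_def by force
    have only_one: "x = \<one>" if x0: "x \<in> FF" "x \<otimes> y = y \<otimes> x" for x
    proof -
      obtain j where x: "x = \<tau> j 1" "j < p" using x0 by (auto simp: FF_def)
      have "\<tau> j h = \<tau> (j * h mod p) h"
        using x0(2) x y tau_mult[of j 1 0 h] tau_mult[of 0 h j 1] by simp
      \<comment> \<open>Since \<open>h \<noteq> 1\<close>, the factor \<open>h\<close> cannot fix a non-zero residue \<open>j\<close>.\<close>
      then have "j = j * h mod p" using tau_inj[of j h "j * h mod p" h] x y by auto
      then have "[j * 1 = j * h] (mod p)" using x by (simp add: cong_def)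
      then have "p dvd j \<or> [1 = h] (mod p)"
        using cong_mult_lcancel_nat prime_p prime_imp_coprime coprime_commute by metis
      moreover have "\<not> [1 = h] (mod p)" using y by (auto simp: cong_def)
      ultimately have "j = 0" using x by (auto dest: dvd_imp_le)
      then show ?thesis using x tau_one by simp
    qed
    have "\<one> \<in> FF" using subgroup.one_closed[OF subgroup_FF] by simp
    moreover have "y \<in> carrier \<Gamma>" using y in_carrier by simp
    ultimately have "\<one> \<in> {x \<in> FF. x \<otimes>\<^bsub>\<Lambda>\<^esub> y = y \<otimes>\<^bsub>\<Lambda>\<^esub> x}" by simp
    moreover have "{x \<in> FF. x \<otimes>\<^bsub>\<Lambda>\<^esub> y = y \<otimes>\<^bsub>\<Lambda>\<^esub> x} \<subseteq> {\<one>}"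
      using only_one by (intro subsetI) simp
    ultimately have "{x \<in> FF. x \<otimes>\<^bsub>\<Lambda>\<^esub> y = y \<otimes>\<^bsub>\<Lambda>\<^esub> x} = {\<one>}" by blast
    then show "{x \<in> FF. x \<otimes>\<^bsub>\<Lambda>\<^esub> y = y \<otimes>\<^bsub>\<Lambda>\<^esub> x} = {\<one>\<^bsub>\<Lambda>\<^esub>}" by simp
  qed
qed

lemma tau_1_pow: "\<tau> 1 1 [^] (n::nat) = \<tau> (n mod p) 1"
proof (induction n)
  case 0 then show ?case by (simp add: tau_one[simplified])
next
  case (Suc n) then show ?case by (simp add: tau_1_mult[simplified] mod_Suc_eq)
qed

lemma tau_0_pow: "g \<in> {1..<p} \<Longrightarrow> \<tau> 0 g [^] (n::nat) = \<tau> 0 (g ^ n mod p)"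
proof (induction n)
  case 0 then show ?case by (simp add: tau_one[simplified])
next
  case (Suc n)
  have "g ^ n mod p \<in> {1..<p}"
  proof -
    have "\<not> p dvd g" using Suc.prems by (auto dest: dvd_imp_le)
    then have "\<not> p dvd g ^ n" using prime_p prime_dvd_power by blast
    then show ?thesis by (auto simp: Suc_le_eq dvd_eq_mod_eq_0)
  qed
  with Suc show ?case by (simp add: tau_0_mult[simplified] mod_mult_right_eq mult.commute)
qed

text \<open>The translations form a cyclic normal subgroup, and the quotient is generated by the multiplication
  by a primitive root.\<close>

lemma metacyclic_Lambda: "metacyclic_group \<Lambda>"
  unfolding metacyclic_group_def
proof (intro conjI exI group_Lambda)
  show "FF \<lhd> \<Lambda>" by (rule normal_FF)
  let ?F = "\<Lambda>\<lparr>carrier := FF\<rparr>"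
  have gF: "group ?F" using subgroup.subgroup_is_group[OF subgroup_FF group_Lambda] .
  show "cyclic_group ?F"
    unfolding group.cyclic_group[OF gF]
  proof
    show t: "\<tau> 1 1 \<in> carrier ?F" by (auto simp: FF_def)
    have "\<tau> j 1 \<in> range (\<lambda>n::int. \<tau> 1 1 [^]\<^bsub>?F\<^esub> n)" if "j < p" for j
    proof -
      have "\<tau> 1 1 [^]\<^bsub>?F\<^esub> (int j) = \<tau> 1 1 [^] j"
        by (simp add: int_pow_int flip: nat_pow_consistent)
      also have "\<dots> = \<tau> j 1" using tau_1_pow that by simp
      finally show ?thesis by (metis rangeI)
    qed
    moreover have "\<tau> 1 1 [^]\<^bsub>?F\<^esub> (n::int) \<in> carrier ?F" for n
      using group.int_pow_closed[OF gF t] .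
    ultimately show "carrier ?F = range (\<lambda>n::int. \<tau> 1 1 [^]\<^bsub>?F\<^esub> n)"
      by (auto simp: FF_def)
  qed
  interpret N: normal FF \<Lambda> by (rule normal_FF)
  have gM: "group (\<Lambda> Mod FF)" by (rule N.factorgroup_is_group)
  obtain g where g: "g \<in> {1..<p}" "residue_primroot p g"
  proof -
    obtain x where x: "residue_primroot p x" using prime_primitive_root_exists[of p] prime_p by auto
    then have "coprime p (x mod p)" using residue_primroot_def residue_primroot_mod by metis
    then have "x mod p \<noteq> 0" by (intro notI) simp
    then show thesis using that[of "x mod p"] x by (simp add: Suc_le_eq)
  qed
  show "cyclic_group (\<Lambda> Mod FF)"
    unfolding group.cyclic_group[OF gM]
  proof
    let ?x = "FF #>\<^bsub>\<Lambda>\<^esub> \<tau> 0 g"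
    have tA: "\<tau> 0 g \<in> carrier \<Lambda>" using g by (auto intro!: AA_I)
    show x: "?x \<in> carrier (\<Lambda> Mod FF)" using tA by (auto simp: FactGroup_def RCOSETS_def)
    show "carrier (\<Lambda> Mod FF) = range (\<lambda>n::int. ?x [^]\<^bsub>\<Lambda> Mod FF\<^esub> n)"
    proof
      show "range (\<lambda>n::int. ?x [^]\<^bsub>\<Lambda> Mod FF\<^esub> n) \<subseteq> carrier (\<Lambda> Mod FF)"
        using group.int_pow_closed[OF gM x] by blast
      show "carrier (\<Lambda> Mod FF) \<subseteq> range (\<lambda>n::int. ?x [^]\<^bsub>\<Lambda> Mod FF\<^esub> n)"
      proof
        fix Y assume "Y \<in> carrier (\<Lambda> Mod FF)"
        then obtain y where y: "y \<in> AA" "Y = FF #>\<^bsub>\<Lambda>\<^esub> y" by (auto simp: FactGroup_def RCOSETS_def)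
        then obtain j h where jh: "y = \<tau> j h" "j < p" "h \<in> {1..<p}" by (auto simp: AA_def)
        have hA: "\<tau> 0 h \<in> carrier \<Lambda>" using jh by (auto intro!: AA_I)
        have "\<tau> j h \<in> FF #>\<^bsub>\<Lambda>\<^esub> \<tau> 0 h"
          using tau_split[OF jh(2,3)] jh by (auto simp: r_coset_def FF_def)
        then have Y: "Y = FF #>\<^bsub>\<Lambda>\<^esub> \<tau> 0 h"
          using y jh group.repr_independence[OF group_Lambda _ hA subgroup_FF] by auto
        have "\<not> p dvd h" using jh by (auto dest: dvd_imp_le)
        then have "coprime p h" using prime_p prime_imp_coprime by blast
        moreover have "h \<in> totatives p" using jh calculation
          by (auto simp: totatives_def coprime_commute)
        ultimately obtain i where i: "h = g ^ i mod p"
          using residue_primroot_is_generator[OF _ g(2)] by (auto simp: bij_betw_def)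
        have "?x [^]\<^bsub>\<Lambda> Mod FF\<^esub> (int i) = FF #>\<^bsub>\<Lambda>\<^esub> (\<tau> 0 g [^]\<^bsub>\<Lambda>\<^esub> i)"
          using N.FactGroup_pow[OF tA, of i] by (simp add: int_pow_int)
        also have "\<tau> 0 g [^]\<^bsub>\<Lambda>\<^esub> i = \<tau> 0 g [^] i" by (simp flip: nat_pow_consistent)
        also have "\<dots> = \<tau> 0 h" using tau_0_pow g i by simp
        finally show "Y \<in> range (\<lambda>n::int. ?x [^]\<^bsub>\<Lambda> Mod FF\<^esub> n)" using Y by (metis rangeI)
      qed
    qed
  qed
qed

end

section \<open>Groups with an action of the affine group\<close>

text \<open>The restrictions of the maps \<open>act j h\<close> to the carrier form a copy of the affine group in the
  automorphism group.\<close>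

lemma affine_action_frobenius:
  fixes G :: "('a, 'b) monoid_scheme"
  assumes "group G" "prime p" "2 < p" "affine_action p G act"
    and F_fix: "\<And>x. x \<in> carrier G \<Longrightarrow> (\<forall>j<p. act j 1 x = x) \<Longrightarrow> x = \<one>\<^bsub>G\<^esub>"
    and H_fix: "\<And>x y. x \<in> carrier G \<Longrightarrow> y \<in> carrier G \<Longrightarrow> (\<forall>h\<in>{1..<p}. act 0 h x = x) \<Longrightarrow>
      (\<forall>h\<in>{1..<p}. act 0 h y = y) \<Longrightarrow> x \<otimes>\<^bsub>G\<^esub> y = y \<otimes>\<^bsub>G\<^esub> x"
  shows "\<exists>A F H.
      subgroup A (AutoGroup G) \<and>
      frobenius_group ((AutoGroup G)\<lparr>carrier := A\<rparr>) F H \<and>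
      metacyclic_group ((AutoGroup G)\<lparr>carrier := A\<rparr>) \<and>
      fixed_points G F = {\<one>\<^bsub>G\<^esub>} \<and>
      comm_group (G\<lparr>carrier := fixed_points G H\<rparr>)"
proof -
  interpret G: group G by fact
  let ?C = "carrier G"
  have hom: "act j h \<in> hom G G" if "j < p" "h \<in> {1..<p}" for j h
    using assms(4) that unfolding affine_action_def by blast
  have id: "act 0 1 x = x" if "x \<in> ?C" for x
    using assms(4) that unfolding affine_action_def by blast
  have comp: "act j h (act k g x) = act ((j + k * h) mod p) (h * g mod p) x"
    if "j < p" "h \<in> {1..<p}" "k < p" "g \<in> {1..<p}" "x \<in> ?C" for j h k g x
    using assms(4) that unfolding affine_action_def by blast
  have faithful: "j = 0 \<and> h = 1" if "j < p" "h \<in> {1..<p}" "\<And>x. x \<in> ?C \<Longrightarrow> act j h x = x" for j h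
    using assms(4) that unfolding affine_action_def by blast
  have cl: "act j h x \<in> ?C" if "j < p" "h \<in> {1..<p}" "x \<in> ?C" for j h x
    using hom[OF that(1,2)] that(3) by (auto simp: hom_def)
  have p1: "1 < p" "0 < p" using assms by auto
  have linv: "\<exists>k g. k < p \<and> g \<in> {1..<p} \<and> (\<forall>x\<in>?C. act k g (act j h x) = x) \<and> (\<forall>x\<in>?C. act j h (act k g x) = x) \<and> (h * g mod p = 1)
       \<and> (k + j * g) mod p = 0"
    if jh: "j < p" "h \<in> {1..<p}" for j h
  proof -
    obtain g where g: "g \<in> {1..<p}" "(h * g) mod p = 1" "(g * h) mod p = 1"
      using mod_mult_cancel_nat[OF assms(2) jh(2)] by blast
    define k where "k = (p - j) * g mod p"
    have k: "k < p" using p1 by (simp add: k_def)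
    have "(k + j * g) mod p = ((p - j) * g + j * g) mod p"
      by (simp add: k_def mod_add_left_eq)
    also have "(p - j) * g + j * g = p * g"
      using jh(1) by (simp flip: add_mult_distrib)
    finally have k0: "(k + j * g) mod p = 0" by simp
    have "(j + k * h) mod p = (j + (p - j) * g * h mod p) mod p"
      unfolding k_def by (metis mod_mult_left_eq mod_add_right_eq)
    also have "(p - j) * g * h mod p = (p - j) * (g * h mod p) mod p"
      by (simp add: mod_mult_right_eq mult.assoc)
    also have "(j + \<dots>) mod p = 0" using g jh by (simp add: mod_add_right_eq)
    finally have k1: "(j + k * h) mod p = 0" .
    show ?thesis using k g k0 k1 comp jh id by (intro exI[of _ k] exI[of _ g]) (simp add: mult.commute)
  qed
  define \<tau> where "\<tau> j h = restrict (act j h) ?C" for j h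
  have Bij: "\<tau> j h \<in> Bij ?C" if jh: "j < p" "h \<in> {1..<p}" for j h
  proof -
    obtain k g where kg: "k < p" "g \<in> {1..<p}" "\<forall>x\<in>?C. act k g (act j h x) = x" "\<forall>x\<in>?C. act j h (act k g x) = x"
      using linv[OF jh] by blast
    have "bij_betw (act j h) ?C ?C"
      using kg cl jh by (intro bij_betw_byWitness[where f' = "act k g"]) auto
    then have "bij_betw (\<tau> j h) ?C ?C" 
      by (subst bij_betw_cong[where g = "act j h"]) (simp_all add: \<tau>_def)
    then show ?thesis by (simp add: Bij_def \<tau>_def)
  qed
  have auto: "\<tau> j h \<in> auto G" if jh: "j < p" "h \<in> {1..<p}" for j h
    using Bij[OF jh] hom[OF jh] by (auto simp: auto_def \<tau>_def hom_def)
  interpret Au: affine_family "AutoGroup G" p \<tau>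
  proof (intro affine_family.intro affine_family_axioms.intro G.AutoGroup assms(2,3))
    fix j h assume jh: "j < p" "h \<in> {1..<p}"
    show "\<tau> j h \<in> carrier (AutoGroup G)" using auto jh by (simp add: AutoGroup_def)
    fix k g assume kg: "k < p" "g \<in> {1..<p}"
    show "\<tau> j h \<otimes>\<^bsub>AutoGroup G\<^esub> \<tau> k g = \<tau> ((j + k * h) mod p) (h * g mod p)"
      using Bij jh kg comp cl
      by (auto simp: AutoGroup_def BijGroup_def compose_def \<tau>_def fun_eq_iff)
    assume eq: "\<tau> j h = \<tau> k g"
    then have eq': "act j h x = act k g x" if "x \<in> ?C" for x
      using that unfolding \<tau>_def by (metis restrict_apply')
    obtain k' g' where inv: "k' < p" "g' \<in> {1..<p}" "\<forall>x\<in>?C. act k' g' (act k g x) = x" "g * g' mod p = 1"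
       "(k' + k * g') mod p = 0"
    proof -
      from linv[OF kg] obtain k' g' where "k' < p \<and> g' \<in> {1..<p} \<and> (\<forall>x\<in>?C. act k' g' (act k g x) = x) \<and>
        (\<forall>x\<in>?C. act k g (act k' g' x) = x) \<and> g * g' mod p = 1 \<and> (k' + k * g') mod p = 0"
        by (elim exE)
      then show thesis using that[of k' g'] by simp
    qed
    have "act ((k' + j * g') mod p) (g' * h mod p) x = x" if "x \<in> ?C" for x
      using comp[of k' g' j h x] inv jh kg eq' that by auto
    moreover have "g' * h mod p \<in> {1..<p}" using mult_mod_prime_range assms(2) inv jh by blast
    ultimately have "(k' + j * g') mod p = 0" "g' * h mod p = 1"
      using faithful[of "(k' + j * g') mod p" "g' * h mod p"] p1 by auto
    then have "[k' + j * g' = k' + k * g'] (mod p)" "[h * g' = g * g'] (mod p)"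
      using inv by (auto simp: cong_def mult.commute)
    moreover have "coprime g' p"
    proof -
      have "\<not> p dvd g'" using inv by (auto dest: dvd_imp_le)
      then show ?thesis using assms(2) prime_imp_coprime coprime_commute by blast
    qed
    ultimately have "[j = k] (mod p)" "[h = g] (mod p)"
      by (auto simp: cong_add_lcancel_nat cong_mult_rcancel_nat)
    then show "j = k \<and> h = g" using jh kg by (auto simp: cong_def)
  qed
  have one: "act j h \<one>\<^bsub>G\<^esub> = \<one>\<^bsub>G\<^esub>" if "j < p" "h \<in> {1..<p}" for j h
    using hom_one[OF hom[OF that]] assms by blast
  have "fixed_points G Au.FF = {\<one>\<^bsub>G\<^esub>}"
  proof
    show "{\<one>\<^bsub>G\<^esub>} \<subseteq> fixed_points G Au.FF"
      using one p1 by (auto simp: fixed_points_def Au.FF_def \<tau>_def)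
    show "fixed_points G Au.FF \<subseteq> {\<one>\<^bsub>G\<^esub>}"
    proof
      fix x assume x: "x \<in> fixed_points G Au.FF"
      then have xC: "x \<in> ?C" by (simp add: fixed_points_def)
      moreover have "act j 1 x = x" if "j < p" for j
      proof -
        have "\<tau> j 1 \<in> Au.FF" using that by (auto simp: Au.FF_def)
        then have "\<tau> j 1 x = x" using x by (auto simp: fixed_points_def)
        then show ?thesis using xC by (simp add: \<tau>_def)
      qed
      ultimately show "x \<in> {\<one>\<^bsub>G\<^esub>}" using F_fix by blast
    qed
  qed
  moreover have "comm_group (G\<lparr>carrier := fixed_points G Au.HH\<rparr>)"
  proof -
    have act_fix: "act 0 h x = x" if "x \<in> fixed_points G Au.HH" "h \<in> {1..<p}" for h x
    proof -
      have "\<tau> 0 h \<in> Au.HH" using that by (auto simp: Au.HH_def)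
      then have "\<tau> 0 h x = x" using that by (auto simp: fixed_points_def)
      then show ?thesis using that by (simp add: \<tau>_def fixed_points_def)
    qed
    have fixI: "x \<in> fixed_points G Au.HH" if "x \<in> ?C" "\<And>h. h \<in> {1..<p} \<Longrightarrow> act 0 h x = x" for x
      using that by (auto simp: fixed_points_def Au.HH_def \<tau>_def)
    have fC: "x \<in> ?C" if "x \<in> fixed_points G Au.HH" for x using that by (simp add: fixed_points_def)
    have gh: "group_hom G G (act 0 h)" if "h \<in> {1..<p}" for h
      using hom[OF p1(2) that] by (simp add: group_hom_def group_hom_axioms_def G.group_axioms)
    have "subgroup (fixed_points G Au.HH) G"
    proof (rule G.subgroupI)
      show "fixed_points G Au.HH \<subseteq> ?C" using fC by blast
      show "fixed_points G Au.HH \<noteq> {}" using fixI[of "\<one>\<^bsub>G\<^esub>"] one p1 by auto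
    next
      fix a assume a: "a \<in> fixed_points G Au.HH"
      show "inv\<^bsub>G\<^esub> a \<in> fixed_points G Au.HH"
        using fC[OF a] act_fix[OF a] group_hom.hom_inv[OF gh] by (intro fixI) auto
    next
      fix a b assume a: "a \<in> fixed_points G Au.HH" and b: "b \<in> fixed_points G Au.HH"
      show "a \<otimes>\<^bsub>G\<^esub> b \<in> fixed_points G Au.HH"
        using fC[OF a] fC[OF b] act_fix[OF a] act_fix[OF b] group_hom.hom_mult[OF gh]
        by (intro fixI) auto
    qed
    then have g: "group (G\<lparr>carrier := fixed_points G Au.HH\<rparr>)"
      using subgroup.subgroup_is_group G.group_axioms by blast
    show ?thesis
      by (rule group.group_comm_groupI[OF g]) (use H_fix fC act_fix in auto)
  qed
  ultimately show ?thesis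
    using Au.subgroup_AA Au.frobenius_Lambda Au.metacyclic_Lambda by blast
qed

lemma (in group_hom) lower_central_image:
  assumes "h ` carrier G = carrier H"
  shows "lower_central H n = h ` lower_central G n \<and> lower_central G n \<subseteq> carrier G"
proof (induction n)
  case 0
  then show ?case using assms by simp
next
  case (Suc n)
  let ?K = "\<Union>x\<in>lower_central G n. \<Union>k\<in>carrier G. {x \<otimes> k \<otimes> inv x \<otimes> inv k}"
  have K: "?K \<subseteq> carrier G" using conjunct2[OF Suc] by (auto dest: subsetD)
  have "(\<Union>x\<in>lower_central H n. \<Union>k\<in>carrier H. {x \<otimes>\<^bsub>H\<^esub> k \<otimes>\<^bsub>H\<^esub> inv\<^bsub>H\<^esub> x \<otimes>\<^bsub>H\<^esub> inv\<^bsub>H\<^esub> k}) = h ` ?K"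
  proof -
    have "(h x \<otimes>\<^bsub>H\<^esub> h k \<otimes>\<^bsub>H\<^esub> inv\<^bsub>H\<^esub> (h x) \<otimes>\<^bsub>H\<^esub> inv\<^bsub>H\<^esub> (h k)) = h (x \<otimes> k \<otimes> inv x \<otimes> inv k)"
      if "x \<in> lower_central G n" "k \<in> carrier G" for x k
      using that Suc by (simp add: subset_iff)
    then show ?thesis
      unfolding conjunct1[OF Suc] assms[symmetric] image_UN by simp
  qed
  then have "lower_central H (Suc n) = generate H (h ` ?K)" by (simp add: commutator_subgroup_def)
  also have "\<dots> = h ` generate G ?K" using generate_img[OF K] by simp
  finally show ?case using G.generate_incl[OF K] by (simp add: commutator_subgroup_def)
qed

text \<open>Every finite group is isomorphic to one whose elements are natural numbers.\<close>

lemma nat_copy: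
  fixes G :: "('a, 'b) monoid_scheme"
  assumes "group G" "finite (carrier G)"
  obtains N :: "nat monoid" and e where "group N" "e \<in> iso G N"
proof -
  obtain e :: "'a \<Rightarrow> nat" where e: "inj_on e (carrier G)"
    using finite_imp_inj_to_nat_seg[OF assms(2)] by blast
  define d where "d = inv_into (carrier G) e"
  define N where "N = \<lparr>carrier = e ` carrier G, monoid.mult = (\<lambda>x y. e (d x \<otimes>\<^bsub>G\<^esub> d y)), one = e \<one>\<^bsub>G\<^esub>\<rparr>"
  have de: "d (e x) = x" if "x \<in> carrier G" for x using e that by (simp add: d_def)
  have i: "e \<in> iso G N" using e de
    by (auto simp: iso_def hom_def N_def bij_betw_def)
  then have "group (N\<lparr>one := e \<one>\<^bsub>G\<^esub>\<rparr>)" using group.iso_imp_img_group[OF assms(1)] by blast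
  then have "group N" by (simp add: N_def)
  with i show thesis using that by blast
qed

lemma affine_action_iso:
  assumes G: "group G" and N: "group N" and e: "e \<in> iso G N" and A: "affine_action p G act"
  shows "affine_action p N (\<lambda>j h y. e (act j h (inv_into (carrier G) e y)))"
proof -
  let ?d = "inv_into (carrier G) e"
  have bij: "bij_betw e (carrier G) (carrier N)" and he: "e \<in> hom G N" using e by (auto simp: iso_def)
  have d: "?d \<in> hom N G" "?d y \<in> carrier G" if "y \<in> carrier N" for y
    using group.iso_set_sym[OF G e] that by (auto simp: iso_def hom_def)
  have de: "?d (e x) = x" if "x \<in> carrier G" for x using bij that by (simp add: bij_betw_def)
  have ed: "e (?d y) = y" if "y \<in> carrier N" for y using bij that by (auto simp: bij_betw_def f_inv_into_f)
  have eN: "e x \<in> carrier N" if "x \<in> carrier G" for x using bij that by (auto simp: bij_betw_def)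
  have cl: "act j h x \<in> carrier G" if "j < p" "h \<in> {1..<p}" "x \<in> carrier G" for j h x
    using A that unfolding affine_action_def by (meson hom_in_carrier)
  show ?thesis unfolding affine_action_def
  proof (intro conjI allI impI ballI)
    fix j h assume jh: "j < p" "h \<in> {1..<p}"
    have "act j h \<in> hom G G" using A jh unfolding affine_action_def by blast
    then have m: "act j h (x \<otimes>\<^bsub>G\<^esub> y) = act j h x \<otimes>\<^bsub>G\<^esub> act j h y" if "x \<in> carrier G" "y \<in> carrier G" for x y
      using that by (rule hom_mult)
    show "(\<lambda>y. e (act j h (?d y))) \<in> hom N N"
    proof (rule homI)
      fix x y assume xy: "x \<in> carrier N" "y \<in> carrier N"
      show "e (act j h (?d x)) \<in> carrier N" using xy d eN cl jh by simp
      show "e (act j h (?d (x \<otimes>\<^bsub>N\<^esub> y))) = e (act j h (?d x)) \<otimes>\<^bsub>N\<^esub> e (act j h (?d y))"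
        using xy hom_mult[OF d(1)[OF xy(1)] xy] m d(2) cl[OF jh] hom_mult[OF he] by simp
    qed
  next
    fix y assume "y \<in> carrier N"
    then show "e (act 0 1 (?d y)) = y" using A d ed unfolding affine_action_def by simp
  next
    fix j h k g y assume "j < p" "h \<in> {1..<p}" "k < p" "g \<in> {1..<p}" "y \<in> carrier N"
    then show "e (act j h (?d (e (act k g (?d y))))) = e (act ((j + k * h) mod p) (h * g mod p) (?d y))"
      using A d de cl unfolding affine_action_def by simp
  next
    fix j h assume jh: "j < p" "h \<in> {1..<p}" and "\<forall>y\<in>carrier N. e (act j h (?d y)) = y"
    then have "act j h x = x" if "x \<in> carrier G" for x
      using that eN de cl jh by metis
    then have *: "j = 0 \<and> h = 1" using A jh unfolding affine_action_def by blast
    show "j = 0" "h = 1" using * by auto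
  qed
qed

section \<open>Functions of bounded degree on a permutation module\<close>

text \<open>\<open>S\<close> is a finite subring of a field, \<open>\<omega>\<close> a primitive \<open>p\<close>-th root of unity in \<open>S\<close>, and \<open>p\<close> is not the
  characteristic. The finite ring is kept as a subset of a fixed field since its size varies with \<open>p\<close>.\<close>

locale coefficient_field =
  fixes S :: "'k::field set" and \<omega> :: 'k and p :: nat
  assumes prime_p: "prime p" and p_gt_2: "2 < p"
    and finite_S: "finite S" and zero_S: "0 \<in> S" and one_S: "1 \<in> S"
    and add_S: "\<And>x y. x \<in> S \<Longrightarrow> y \<in> S \<Longrightarrow> x + y \<in> S"
    and minus_S: "\<And>x. x \<in> S \<Longrightarrow> - x \<in> S"
    and mult_S: "\<And>x y. x \<in> S \<Longrightarrow> y \<in> S \<Longrightarrow> x * y \<in> S"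
    and omega_S: "\<omega> \<in> S" and omega_pow_p: "\<omega> ^ p = 1" and omega_neq_1: "\<omega> \<noteq> 1"
    and p_neq_0: "of_nat p \<noteq> (0::'k)"
begin

lemma p_pos: "0 < p" "1 < p" "Suc 0 < p"
  using p_gt_2 by auto

lemma diff_S: "x \<in> S \<Longrightarrow> y \<in> S \<Longrightarrow> x - y \<in> S"
  using add_S[of x "- y"] minus_S by simp

lemma power_S: "x \<in> S \<Longrightarrow> x ^ m \<in> S"
  by (induction m) (auto intro: one_S mult_S)

lemma sum_S: "(\<And>i. i \<in> I \<Longrightarrow> f i \<in> S) \<Longrightarrow> sum f I \<in> S"
  by (induction I rule: infinite_finite_induct) (auto intro: zero_S add_S)

lemma prod_S: "(\<And>i. i \<in> I \<Longrightarrow> f i \<in> S) \<Longrightarrow> prod f I \<in> S"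
  by (induction I rule: infinite_finite_induct) (auto intro: one_S mult_S)

lemma omega_pow_mod: "\<omega> ^ (m mod p) = \<omega> ^ m"
proof -
  have "\<omega> ^ m = \<omega> ^ (p * (m div p) + m mod p)" by simp
  also have "\<dots> = \<omega> ^ (m mod p)" unfolding power_add power_mult omega_pow_p by simp
  finally show ?thesis by simp
qed

lemma omega_pow_cong: "[m = m'] (mod p) \<Longrightarrow> \<omega> ^ m = \<omega> ^ m'"
  by (metis cong_def omega_pow_mod)

lemma omega_pow_eq_1_iff: "\<omega> ^ m = 1 \<longleftrightarrow> p dvd m"
proof
  assume "p dvd m"
  then show "\<omega> ^ m = 1" by (metis dvdE omega_pow_p power_mult power_one)
next
  assume m: "\<omega> ^ m = 1"
  show "p dvd m"
  proof (rule ccontr)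
    assume "\<not> p dvd m"
    then have "coprime m p" using prime_p prime_imp_coprime coprime_commute by blast
    then obtain x where "[m * x = 1] (mod p)" using cong_solve_coprime_nat by auto
    then have "\<omega> ^ (m * x) = \<omega> ^ 1" by (rule omega_pow_cong)
    then show False using m omega_neq_1 by (simp add: power_mult)
  qed
qed

lemma sum_omega_pow:
  assumes "\<not> p dvd m" shows "(\<Sum>j<p. \<omega> ^ (j * m)) = 0"
proof -
  have "(\<omega> ^ m - 1) * (\<Sum>j<p. (\<omega> ^ m) ^ j) = (\<omega> ^ m) ^ p - 1" by (simp add: power_diff_1_eq)
  also have "\<dots> = 0" by (metis omega_pow_p power_mult mult.commute power_one diff_self)
  finally have "(\<Sum>j<p. (\<omega> ^ m) ^ j) = 0" using assms omega_pow_eq_1_iff by auto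
  then show ?thesis by (simp add: mult.commute flip: power_mult)
qed

text \<open>Vectors over \<open>S\<close> with coordinates \<open>1, \<dots>, p - 1\<close>, extended by zero.\<close>

definition A :: "(nat \<Rightarrow> 'k) set"
  where "A = {a. (\<forall>i. a i \<in> S) \<and> (\<forall>i. i \<notin> {1..<p} \<longrightarrow> a i = 0)}"

text \<open>The affine map \<open>(j, h)\<close> acts on vectors by permuting the coordinates through multiplication of the
  indices by \<open>h\<close>, followed by the diagonal matrix with entries \<open>\<omega> ^ (j * i)\<close>.\<close>

definition aff :: "nat \<Rightarrow> nat \<Rightarrow> (nat \<Rightarrow> 'k) \<Rightarrow> nat \<Rightarrow> 'k"
  where "aff j h a = (\<lambda>i. if i \<in> {1..<p} then \<omega> ^ (j * i) * a (h * i mod p) else 0)"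

text \<open>The vectors with constant coordinates; they are the fixed points of \<open>H\<close>.\<close>

definition const_vec :: "'k \<Rightarrow> nat \<Rightarrow> 'k"
  where "const_vec c = (\<lambda>i. if i \<in> {1..<p} then c else 0)"

lemma A_I: "(\<And>i. a i \<in> S) \<Longrightarrow> (\<And>i. i \<notin> {1..<p} \<Longrightarrow> a i = 0) \<Longrightarrow> a \<in> A"
  unfolding A_def by blast

lemma A_S: "a \<in> A \<Longrightarrow> a i \<in> S"
  unfolding A_def by blast

lemma A_0: "a \<in> A \<Longrightarrow> i \<notin> {1..<p} \<Longrightarrow> a i = 0"
  unfolding A_def by blast

lemma zero_A: "0 \<in> A"
  by (rule A_I) (auto simp: zero_S)

lemma add_A: "a \<in> A \<Longrightarrow> b \<in> A \<Longrightarrow> a + b \<in> A"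
  by (rule A_I) (auto simp: add_S A_S A_0)

lemma minus_A: "a \<in> A \<Longrightarrow> - a \<in> A"
  by (rule A_I) (auto simp: minus_S A_S A_0)

lemma add_A_iff: "a \<in> A \<Longrightarrow> x + a \<in> A \<longleftrightarrow> x \<in> A"
  using add_A[of "x + a" "- a"] minus_A add_A[of x a] by (auto simp: add.assoc)

lemma const_vec_A: "c \<in> S \<Longrightarrow> const_vec c \<in> A"
  by (rule A_I) (auto simp: const_vec_def zero_S)

lemma aff_A: "a \<in> A \<Longrightarrow> aff j h a \<in> A"
  by (rule A_I) (auto simp: aff_def zero_S mult_S power_S omega_S A_S)

lemma finite_A: "finite A"
proof -
  have "A \<subseteq> {f. \<forall>i. (i \<in> {1..<p} \<longrightarrow> f i \<in> S) \<and> (i \<notin> {1..<p} \<longrightarrow> f i = 0)}"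
    by (auto simp: A_def)
  then show ?thesis
    using finite_set_of_finite_funs[of "{1..<p}" S 0] finite_S finite_subset by auto
qed

lemma aff_add: "aff j h (a + b) = aff j h a + aff j h b"
  by (auto simp: aff_def fun_eq_iff algebra_simps)

lemma aff_0: "aff j h 0 = 0"
  by (auto simp: aff_def fun_eq_iff)

lemma aff_aff:
  assumes "h \<in> {1..<p}"
  shows "aff j h (aff k g a) = aff ((j + k * h) mod p) (h * g mod p) a"
proof
  fix i
  show "aff j h (aff k g a) i = aff ((j + k * h) mod p) (h * g mod p) a i"
  proof (cases "i \<in> {1..<p}")
    case True
    have "h * i mod p \<in> {1..<p}" using mult_mod_prime_range[OF prime_p assms True] .
    then have "aff j h (aff k g a) i = \<omega> ^ (j * i) * (\<omega> ^ (k * (h * i mod p)) * a (g * (h * i mod p) mod p))"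
      using True by (simp add: aff_def)
    also have "\<omega> ^ (k * (h * i mod p)) = \<omega> ^ (k * (h * i))"
      by (intro omega_pow_cong cong_mult) (auto simp: cong_def)
    also have "\<omega> ^ (j * i) * (\<omega> ^ (k * (h * i)) * a (g * (h * i mod p) mod p)) =
      \<omega> ^ ((j + k * h) * i) * a (g * (h * i mod p) mod p)"
      by (simp add: power_add algebra_simps)
    also have "\<omega> ^ ((j + k * h) * i) = \<omega> ^ ((j + k * h) mod p * i)"
      by (intro omega_pow_cong cong_mult) (auto simp: cong_def)
    also have "g * (h * i mod p) mod p = (h * g mod p) * i mod p"
      by (metis mod_mult_left_eq mod_mult_right_eq mult.assoc mult.commute)
    finally show ?thesis using True by (simp add: aff_def)
  next
    case False then show ?thesis by (simp only: aff_def if_False)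
  qed
qed

lemma aff_id: "a \<in> A \<Longrightarrow> aff 0 1 a = a"
  by (auto simp: aff_def fun_eq_iff A_0)

text \<open>The pair \<open>(inv_shift j h, inv_scale h)\<close> is the inverse of \<open>(j, h)\<close> in the affine group; the
  inverse of \<open>h\<close> modulo \<open>p\<close> is given by Fermat's theorem.\<close>

definition inv_scale :: "nat \<Rightarrow> nat" where "inv_scale h = h ^ (p - 2) mod p"

lemma inv_scale:
  assumes "h \<in> {1..<p}"
  shows "inv_scale h \<in> {1..<p}" "h * inv_scale h mod p = 1" "inv_scale h * h mod p = 1" "inv_scale (inv_scale h) = h"
proof -
  have inv: "x * inv_scale x mod p = 1" "inv_scale x \<in> {1..<p}" if "x \<in> {1..<p}" for x
  proof -
    have nd: "\<not> p dvd x" using that by (auto dest: dvd_imp_le)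
    have "x * inv_scale x mod p = x * x ^ (p - 2) mod p" by (simp add: inv_scale_def mod_mult_right_eq)
    also have "x * x ^ (p - 2) = x ^ (p - 1)"
      using p_gt_2 by (metis Suc_1 Suc_diff_Suc Suc_lessD numeral_2_eq_2 power_Suc diff_Suc_1 One_nat_def)
    also have "x ^ (p - 1) mod p = 1"
      using fermat_theorem[OF prime_p nd] p_pos by (simp add: cong_def)
    finally show "x * inv_scale x mod p = 1" .
    have "\<not> p dvd x ^ (p - 2)" using nd prime_p prime_dvd_power by blast
    then show "inv_scale x \<in> {1..<p}" using p_pos by (auto simp: inv_scale_def dvd_eq_mod_eq_0 Suc_le_eq)
  qed
  show 1: "inv_scale h \<in> {1..<p}" and 2: "h * inv_scale h mod p = 1" using inv assms by auto
  show 3: "inv_scale h * h mod p = 1" using 2 by (simp add: mult.commute)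
  have "inv_scale (inv_scale h) = (h * inv_scale h mod p) * inv_scale (inv_scale h) mod p" using 2 inv(2)[OF 1] by simp
  also have "\<dots> = h * (inv_scale h * inv_scale (inv_scale h) mod p) mod p"
    by (metis mod_mult_left_eq mod_mult_right_eq mult.assoc)
  also have "\<dots> = h" using inv(1)[OF 1] assms by simp
  finally show "inv_scale (inv_scale h) = h" .
qed

definition inv_shift :: "nat \<Rightarrow> nat \<Rightarrow> nat" where "inv_shift j h = (p - j) * inv_scale h mod p"

lemma inv_shift_less: "inv_shift j h < p"
  using p_pos by (simp add: inv_shift_def)

lemma aff_inverse:
  assumes j: "j < p" and h: "h \<in> {1..<p}" and a: "a \<in> A"
  shows "aff (inv_shift j h) (inv_scale h) (aff j h a) = a" "aff j h (aff (inv_shift j h) (inv_scale h) a) = a"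
proof -
  have "(inv_shift j h + j * inv_scale h) mod p = ((p - j) * inv_scale h + j * inv_scale h) mod p"
    by (simp add: inv_shift_def mod_add_left_eq)
  also have "(p - j) * inv_scale h + j * inv_scale h = p * inv_scale h"
    using j by (simp flip: add_mult_distrib)
  finally have 1: "(inv_shift j h + j * inv_scale h) mod p = 0" by simp
  have "(j + inv_shift j h * h) mod p = (j + (p - j) * inv_scale h * h mod p) mod p"
    unfolding inv_shift_def by (metis mod_mult_left_eq mod_add_right_eq)
  also have "(p - j) * inv_scale h * h mod p = (p - j) * (inv_scale h * h mod p) mod p"
    by (simp add: mod_mult_right_eq mult.assoc)
  also have "(j + \<dots>) mod p = 0" using inv_scale[OF h] j by (simp add: mod_add_right_eq)
  finally have 2: "(j + inv_shift j h * h) mod p = 0" .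
  show "aff (inv_shift j h) (inv_scale h) (aff j h a) = a" "aff j h (aff (inv_shift j h) (inv_scale h) a) = a"
    using 1 2 inv_scale[OF h] h a by (simp_all add: aff_aff aff_id[simplified])
qed

text \<open>\<open>degree_less n P\<close> says that all \<open>n\<close>-fold differences of \<open>P\<close> vanish on \<open>A\<close>, which serves as the
  bound \<open>n - 1\<close> on the degree of \<open>P\<close>. Only the values of \<open>P\<close> on \<open>A\<close> matter.\<close>

primrec degree_less :: "nat \<Rightarrow> ((nat \<Rightarrow> 'k) \<Rightarrow> 'k) \<Rightarrow> bool"
  where
    "degree_less 0 P \<longleftrightarrow> (\<forall>x\<in>A. P x = 0)"
  | "degree_less (Suc n) P \<longleftrightarrow> (\<forall>u\<in>A. degree_less n (\<lambda>x. P (x + u) - P x))"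

lemma degree_less_cong: "(\<And>x. x \<in> A \<Longrightarrow> P x = Q x) \<Longrightarrow> degree_less n P \<longleftrightarrow> degree_less n Q"
proof (induction n arbitrary: P Q)
  case 0 then show ?case by simp
next
  case (Suc n)
  have "degree_less n (\<lambda>x. P (x + u) - P x) \<longleftrightarrow> degree_less n (\<lambda>x. Q (x + u) - Q x)" if "u \<in> A" for u
    using Suc.prems that by (intro Suc.IH) (simp only: add_A)
  then show ?case by auto
qed

lemma degree_less_add: "degree_less n P \<Longrightarrow> degree_less n Q \<Longrightarrow> degree_less n (\<lambda>x. P x + Q x)"
proof (induction n arbitrary: P Q)
  case 0 then show ?case by simp
next
  case (Suc n)
  have "degree_less n (\<lambda>x. (P (x + u) - P x) + (Q (x + u) - Q x))" if "u \<in> A" for u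
    using Suc that by auto
  then show ?case by (simp add: algebra_simps)
qed

lemma degree_less_scale: "degree_less n P \<Longrightarrow> degree_less n (\<lambda>x. c * P x)"
proof (induction n arbitrary: P)
  case 0 then show ?case by simp
next
  case (Suc n)
  have "degree_less n (\<lambda>x. c * (P (x + u) - P x))" if "u \<in> A" for u
    using Suc that by auto
  then show ?case by (simp add: algebra_simps)
qed

lemma degree_less_minus: "degree_less n P \<Longrightarrow> degree_less n (\<lambda>x. - P x)"
  using degree_less_scale[of n P "-1"] by simp

lemma degree_less_shift: "degree_less n P \<Longrightarrow> b \<in> A \<Longrightarrow> degree_less n (\<lambda>x. P (x + b))"
proof (induction n arbitrary: P)
  case 0 then show ?case by (simp only: degree_less.simps) (blast intro: add_A)
next
  case (Suc n)
  have "degree_less n (\<lambda>x. P (x + u + b) - P (x + b))" if "u \<in> A" for u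
  proof -
    have "degree_less n (\<lambda>x. P (x + u) - P x)" using Suc.prems(1) that by simp
    from Suc.IH[OF this Suc.prems(2)] have "degree_less n (\<lambda>x. P (x + b + u) - P (x + b))" .
    then show ?thesis by (simp only: add.assoc add.commute[of b u])
  qed
  then show ?case by (simp only: degree_less.simps) blast
qed

lemma degree_less_aff: "degree_less n P \<Longrightarrow> degree_less n (\<lambda>x. P (aff j h x))"
proof (induction n arbitrary: P)
  case 0 then show ?case using aff_A by simp
next
  case (Suc n)
  have "degree_less n (\<lambda>x. P (aff j h x + aff j h u) - P (aff j h x))" if "u \<in> A" for u
    using Suc.IH[of "\<lambda>x. P (x + aff j h u) - P x"] Suc.prems that aff_A by simp
  then show ?case by (simp add: aff_add)
qed

lemma degree_less_const_0: "degree_less n (\<lambda>x. 0)"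
  by (induction n) auto

lemma degree_less_normalise: "degree_less n P \<Longrightarrow> degree_less n (\<lambda>x. P x - P 0)"
proof (cases n)
  case 0 then show "degree_less n P \<Longrightarrow> ?thesis" using zero_A by simp
next
  case (Suc m) then show "degree_less n P \<Longrightarrow> ?thesis" by simp
qed

text \<open>The normalised translate \<open>x \<mapsto> P (x + b) - P b\<close> sums to zero over the \<open>F\<close>-orbit of every \<open>a\<close>.\<close>

definition kernel_sum_zero :: "((nat \<Rightarrow> 'k) \<Rightarrow> 'k) \<Rightarrow> bool"
  where "kernel_sum_zero P \<longleftrightarrow> (\<forall>a\<in>A. \<forall>b\<in>A. (\<Sum>j<p. P (aff j 1 a + b) - P b) = 0)"

text \<open>For every \<open>j\<close> and \<open>b\<close> the function \<open>x \<mapsto> (\<Sum>h. P (aff j h x + b) - P b)\<close> is additive in constant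
  directions. Stated with the base point \<open>b\<close>, both conditions are invariant under translations.\<close>

definition complement_sum_zero :: "((nat \<Rightarrow> 'k) \<Rightarrow> 'k) \<Rightarrow> bool"
  where "complement_sum_zero P \<longleftrightarrow> (\<forall>j<p. \<forall>a\<in>A. \<forall>b\<in>A. \<forall>c\<in>S. (\<Sum>h\<in>{1..<p}.
     P (aff j h (a + const_vec c) + b) - P (aff j h (const_vec c) + b) - P (aff j h a + b) + P b) = 0)"

text \<open>The functions of degree less than \<open>n\<close> that satisfy both conditions, normalised at \<open>0\<close> and extended
  by zero outside \<open>A\<close>.\<close>

definition M :: "nat \<Rightarrow> ((nat \<Rightarrow> 'k) \<Rightarrow> 'k) set"
  where "M n = {P. (\<forall>x. P x \<in> S) \<and> (\<forall>x. x \<notin> A \<longrightarrow> P x = 0) \<and> P 0 = 0 \<and> degree_less n P \<and> kernel_sum_zero P \<and> complement_sum_zero P}"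

text \<open>Subtracting \<open>P a\<close> keeps the translate normalised; this amounts to translating functions modulo
  constants.\<close>

definition translate :: "(nat \<Rightarrow> 'k) \<Rightarrow> ((nat \<Rightarrow> 'k) \<Rightarrow> 'k) \<Rightarrow> (nat \<Rightarrow> 'k) \<Rightarrow> 'k"
  where "translate a P = (\<lambda>x. if x \<in> A then P (x + a) - P a else 0)"

definition pullback :: "nat \<Rightarrow> nat \<Rightarrow> ((nat \<Rightarrow> 'k) \<Rightarrow> 'k) \<Rightarrow> (nat \<Rightarrow> 'k) \<Rightarrow> 'k"
  where "pullback k g P = (\<lambda>x. if x \<in> A then P (aff k g x) else 0)"

lemma M_D:
  assumes "P \<in> M n"
  shows "P x \<in> S" "x \<notin> A \<Longrightarrow> P x = 0" "P 0 = 0" "degree_less n P" "kernel_sum_zero P" "complement_sum_zero P"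
  using assms unfolding M_def by auto

lemma kernel_sum_zero_cong:
  assumes "\<And>x. x \<in> A \<Longrightarrow> P x = Q x"
  shows "kernel_sum_zero P \<longleftrightarrow> kernel_sum_zero Q"
  unfolding kernel_sum_zero_def using assms aff_A add_A by (intro ball_cong arg_cong2[of _ _ _ _ "(=)"] sum.cong) auto

lemma complement_sum_zero_cong:
  assumes "\<And>x. x \<in> A \<Longrightarrow> P x = Q x"
  shows "complement_sum_zero P \<longleftrightarrow> complement_sum_zero Q"
proof -
  have *: "P (aff j h (a + const_vec c) + b) - P (aff j h (const_vec c) + b) - P (aff j h a + b) + P b =
        Q (aff j h (a + const_vec c) + b) - Q (aff j h (const_vec c) + b) - Q (aff j h a + b) + Q b"
    if "a \<in> A" "b \<in> A" "c \<in> S" for a b c j h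
    using assms aff_A add_A const_vec_A that by simp
  show ?thesis unfolding complement_sum_zero_def using * by (simp cong: ball_cong)
qed

lemma zero_M: "0 \<in> M n"
  by (auto simp: M_def zero_S zero_fun_def degree_less_const_0 kernel_sum_zero_def complement_sum_zero_def)

lemma add_M: assumes "P \<in> M n" "Q \<in> M n" shows "P + Q \<in> M n"
proof -
  have "kernel_sum_zero (P + Q)" unfolding kernel_sum_zero_def
  proof (intro ballI)
    fix a b assume ab: "a \<in> A" "b \<in> A"
    have "(\<Sum>j<p. (P + Q) (aff j 1 a + b) - (P + Q) b) =
      (\<Sum>j<p. P (aff j 1 a + b) - P b) + (\<Sum>j<p. Q (aff j 1 a + b) - Q b)"
      unfolding sum.distrib[symmetric] by (intro sum.cong) (auto simp: algebra_simps)
    then show "(\<Sum>j<p. (P + Q) (aff j 1 a + b) - (P + Q) b) = 0"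
      using M_D(5)[OF assms(1)] M_D(5)[OF assms(2)] ab unfolding kernel_sum_zero_def by simp
  qed
  moreover have "complement_sum_zero (P + Q)" unfolding complement_sum_zero_def
  proof (intro ballI allI impI)
    fix j a b c assume ab: "j < p" "a \<in> A" "b \<in> A" "c \<in> S"
    let ?d = "\<lambda>P h. P (aff j h (a + const_vec c) + b) - P (aff j h (const_vec c) + b) - P (aff j h a + b) + P b"
    have "(\<Sum>h\<in>{1..<p}. ?d (P + Q) h) = (\<Sum>h\<in>{1..<p}. ?d P h) + (\<Sum>h\<in>{1..<p}. ?d Q h)"
      unfolding sum.distrib[symmetric] by (intro sum.cong) (auto simp: algebra_simps)
    then show "(\<Sum>h\<in>{1..<p}. ?d (P + Q) h) = 0"
      using M_D(6)[OF assms(1)] M_D(6)[OF assms(2)] ab unfolding complement_sum_zero_def by simp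
  qed
  moreover have "degree_less n (P + Q)" using degree_less_add[of n P Q] M_D(4) assms by (simp add: plus_fun_def)
  ultimately show ?thesis using M_D(1-3)[OF assms(1)] M_D(1-3)[OF assms(2)] unfolding M_def by (simp add: add_S)
qed

lemma minus_M: assumes "P \<in> M n" shows "- P \<in> M n"
proof -
  have "kernel_sum_zero (- P)" unfolding kernel_sum_zero_def
  proof (intro ballI)
    fix a b assume ab: "a \<in> A" "b \<in> A"
    have "(\<Sum>j<p. (- P) (aff j 1 a + b) - (- P) b) = - (\<Sum>j<p. P (aff j 1 a + b) - P b)"
      unfolding sum_negf[symmetric] by (intro sum.cong) (auto simp: algebra_simps)
    then show "(\<Sum>j<p. (- P) (aff j 1 a + b) - (- P) b) = 0"
      using M_D(5)[OF assms(1)] ab unfolding kernel_sum_zero_def by simp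
  qed
  moreover have "complement_sum_zero (- P)" unfolding complement_sum_zero_def
  proof (intro ballI allI impI)
    fix j a b c assume ab: "j < p" "a \<in> A" "b \<in> A" "c \<in> S"
    let ?d = "\<lambda>P h. P (aff j h (a + const_vec c) + b) - P (aff j h (const_vec c) + b) - P (aff j h a + b) + P b"
    have "(\<Sum>h\<in>{1..<p}. ?d (- P) h) = - (\<Sum>h\<in>{1..<p}. ?d P h)"
      unfolding sum_negf[symmetric] by (intro sum.cong) (auto simp: algebra_simps)
    then show "(\<Sum>h\<in>{1..<p}. ?d (- P) h) = 0"
      using M_D(6)[OF assms(1)] ab unfolding complement_sum_zero_def by simp
  qed
  moreover have "degree_less n (- P)" using degree_less_minus[of n P] M_D(4) assms by (simp add: fun_Compl_def)
  ultimately show ?thesis using M_D(1-3)[OF assms(1)] unfolding M_def by (simp add: minus_S)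
qed

lemma translate_M: assumes P: "P \<in> M n" and u: "u \<in> A" shows "translate u P \<in> M n"
proof -
  let ?P = "\<lambda>x. P (x + u) - P u"
  have eq: "translate u P x = ?P x" if "x \<in> A" for x using that by (simp add: translate_def)
  have "kernel_sum_zero ?P" unfolding kernel_sum_zero_def
  proof (intro ballI)
    fix a b assume ab: "a \<in> A" "b \<in> A"
    then have "(\<Sum>j<p. P (aff j 1 a + (b + u)) - P (b + u)) = 0"
      using M_D(5)[OF P] u add_A unfolding kernel_sum_zero_def by simp
    then show "(\<Sum>j<p. ?P (aff j 1 a + b) - ?P b) = 0"
      by (simp add: add.assoc)
  qed
  then have 1: "kernel_sum_zero (translate u P)" using kernel_sum_zero_cong[of "translate u P" ?P] eq by auto
  have "complement_sum_zero ?P" unfolding complement_sum_zero_def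
  proof (intro ballI allI impI)
    fix j a b c assume ab: "j < p" "a \<in> A" "b \<in> A" "c \<in> S"
    let ?d = "\<lambda>P b h. P (aff j h (a + const_vec c) + b) - P (aff j h (const_vec c) + b) - P (aff j h a + b) + P b"
    have "(\<Sum>h\<in>{1..<p}. ?d ?P b h) = (\<Sum>h\<in>{1..<p}. ?d P (b + u) h)"
      by (intro sum.cong refl) (simp add: algebra_simps)
    also have "\<dots> = 0"
      using M_D(6)[OF P] ab u add_A unfolding complement_sum_zero_def by blast
    finally show "(\<Sum>h\<in>{1..<p}. ?d ?P b h) = 0" .
  qed
  then have 2: "complement_sum_zero (translate u P)" using complement_sum_zero_cong[of "translate u P" ?P] eq by auto
  have "degree_less n ?P" using degree_less_normalise[OF degree_less_shift[OF M_D(4)[OF P] u]] by simp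
  then have 3: "degree_less n (translate u P)" using degree_less_cong[of "translate u P" ?P] eq by auto
  have "translate u P x \<in> S" for x using M_D(1)[OF P] by (auto simp: translate_def zero_S diff_S)
  then show ?thesis unfolding M_def using 1 2 3 zero_A by (auto simp: translate_def)
qed

text \<open>In both conditions the affine map \<open>(k, g)\<close> only reindexes the sum: composing \<open>(k, g)\<close> with
  \<open>(j, h)\<close> gives \<open>(k + j * g, g * h)\<close>, whose first entry does not depend on \<open>h\<close>.\<close>

lemma pullback_M: assumes P: "P \<in> M n" and k: "k < p" and g: "g \<in> {1..<p}" shows "pullback k g P \<in> M n"
proof -
  let ?P = "\<lambda>x. P (aff k g x)"
  have eq: "pullback k g P x = ?P x" if "x \<in> A" for x using that by (simp add: pullback_def)
  have "kernel_sum_zero ?P" unfolding kernel_sum_zero_def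
  proof (intro ballI)
    fix a b assume ab: "a \<in> A" "b \<in> A"
    define a' where "a' = aff k g a"
    have a': "a' \<in> A" "a = aff (inv_shift k g) (inv_scale g) a'"
      using ab aff_A aff_inverse k g by (auto simp: a'_def)
    have "aff k g (aff j 1 a) = aff (j * g mod p) 1 a'" for j
    proof -
      have "aff (j * g mod p) 1 (aff k g a) = aff ((j * g + k) mod p) g a"
        using p_pos g by (subst aff_aff) (auto simp: mod_add_left_eq)
      moreover have "aff k g (aff j 1 a) = aff ((k + j * g) mod p) g a"
        using g by (subst aff_aff) auto
      ultimately show ?thesis by (simp add: a'_def add.commute)
    qed
    then have "(\<Sum>j<p. ?P (aff j 1 a + b) - ?P b) =
       (\<Sum>j<p. P (aff (j * g mod p) 1 a' + aff k g b) - P (aff k g b))"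
      by (simp add: aff_add)
    also have "\<dots> = (\<Sum>j<p. P (aff j 1 a' + aff k g b) - P (aff k g b))"
    proof (rule sum.reindex_bij_witness[of _ "\<lambda>j. j * inv_scale g mod p" "\<lambda>j. j * g mod p"])
      fix j assume "j \<in> {..<p}"
      then show "j * g mod p * inv_scale g mod p = j" "j * inv_scale g mod p * g mod p = j"
        using inv_scale[OF g]
        by (metis lessThan_iff mod_less mod_mult_left_eq mod_mult_right_eq mult.assoc mult_1_right)+
    qed (use p_pos in auto)
    also have "\<dots> = 0" using M_D(5)[OF P] a' aff_A ab unfolding kernel_sum_zero_def by blast
    finally show "(\<Sum>j<p. ?P (aff j 1 a + b) - ?P b) = 0" .
  qed
  then have 1: "kernel_sum_zero (pullback k g P)" using kernel_sum_zero_cong[of "pullback k g P" ?P] eq by auto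
  have "complement_sum_zero ?P" unfolding complement_sum_zero_def
  proof (intro ballI allI impI)
    fix j a b c assume ab: "j < p" "a \<in> A" "b \<in> A" "c \<in> S"
    let ?d = "\<lambda>P j b h. P (aff j h (a + const_vec c) + b) - P (aff j h (const_vec c) + b) - P (aff j h a + b) + P b"
    have "?d ?P j b h = ?d P ((k + j * g) mod p) (aff k g b) (g * h mod p)" for h
      using g by (simp add: aff_add aff_aff)
    then have "(\<Sum>h\<in>{1..<p}. ?d ?P j b h) = (\<Sum>h\<in>{1..<p}. ?d P ((k + j * g) mod p) (aff k g b) (g * h mod p))"
      by simp
    also have "\<dots> = (\<Sum>h\<in>{1..<p}. ?d P ((k + j * g) mod p) (aff k g b) h)"
    proof (rule sum.reindex_bij_witness[of _ "\<lambda>h. inv_scale g * h mod p" "\<lambda>h. g * h mod p"])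
      fix h assume h: "h \<in> {1..<p}"
      then show "inv_scale g * (g * h mod p) mod p = h" "g * (inv_scale g * h mod p) mod p = h"
        using inv_scale[OF g]
        by (metis atLeastLessThan_iff mod_less mod_mult_left_eq mod_mult_right_eq mult.assoc mult_1)+
      show "g * h mod p \<in> {1..<p}" "inv_scale g * h mod p \<in> {1..<p}"
        using mult_mod_prime_range[OF prime_p] g h inv_scale[OF g] by blast+
    qed auto
    also have "\<dots> = 0" using M_D(6)[OF P] aff_A ab p_pos unfolding complement_sum_zero_def by simp
    finally show "(\<Sum>h\<in>{1..<p}. ?d ?P j b h) = 0" .
  qed
  then have 2: "complement_sum_zero (pullback k g P)" using complement_sum_zero_cong[of "pullback k g P" ?P] eq by auto
  have "degree_less n (pullback k g P)" using degree_less_cong[of "pullback k g P" ?P] eq degree_less_aff[OF M_D(4)[OF P]] by auto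
  moreover have "pullback k g P x \<in> S" for x using M_D(1)[OF P] by (auto simp: pullback_def zero_S)
  moreover have "pullback k g P 0 = 0" using M_D(3)[OF P] by (simp add: pullback_def aff_0)
  ultimately show ?thesis unfolding M_def using 1 2 by (auto simp: pullback_def)
qed

lemma finite_M: "finite (M n)"
proof -
  have "M n \<subseteq> {f. \<forall>x. (x \<in> A \<longrightarrow> f x \<in> S) \<and> (x \<notin> A \<longrightarrow> f x = 0)}"
    by (auto simp: M_def)
  then show ?thesis
    using finite_set_of_finite_funs[of A S 0] finite_S finite_A finite_subset by auto
qed

end

section \<open>The semidirect product\<close>

context coefficient_field
begin

text \<open>The semidirect product of \<open>M n\<close> by \<open>A\<close>.\<close>

definition G :: "nat \<Rightarrow> ((nat \<Rightarrow> 'k) \<times> ((nat \<Rightarrow> 'k) \<Rightarrow> 'k)) monoid"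
  where "G n = \<lparr>carrier = A \<times> M n, monoid.mult = (\<lambda>(a, P) (b, Q). (a + b, P + translate a Q)), one = (0, 0)\<rparr>"

lemma carrier_G: "carrier (G n) = A \<times> M n"
  and one_G: "\<one>\<^bsub>G n\<^esub> = (0, 0)"
  and mult_G: "(a, P) \<otimes>\<^bsub>G n\<^esub> (b, Q) = (a + b, P + translate a Q)"
  by (simp_all add: G_def)

lemma translate_add: "translate a (P + Q) = translate a P + translate a Q"
  by (auto simp: translate_def fun_eq_iff)

lemma translate_tr: "a \<in> A \<Longrightarrow> b \<in> A \<Longrightarrow> translate a (translate b P) = translate (a + b) P"
  by (auto simp: translate_def fun_eq_iff add_A add_A_iff add.assoc)

lemma translate_0: "P \<in> M n \<Longrightarrow> translate 0 P = P"
  using M_D(2,3) by (auto simp: translate_def fun_eq_iff)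

lemma group_G: "group (G n)"
proof (rule groupI)
  fix x y assume "x \<in> carrier (G n)" "y \<in> carrier (G n)"
  then show "x \<otimes>\<^bsub>G n\<^esub> y \<in> carrier (G n)"
    by (auto simp: carrier_G mult_G add_A add_M translate_M)
next
  fix x y z assume "x \<in> carrier (G n)" "y \<in> carrier (G n)" "z \<in> carrier (G n)"
  then show "x \<otimes>\<^bsub>G n\<^esub> y \<otimes>\<^bsub>G n\<^esub> z = x \<otimes>\<^bsub>G n\<^esub> (y \<otimes>\<^bsub>G n\<^esub> z)"
    by (auto simp: carrier_G mult_G translate_add translate_tr add.assoc)
next
  show "\<one>\<^bsub>G n\<^esub> \<in> carrier (G n)" by (simp add: carrier_G one_G zero_A zero_M)
next
  fix x assume x: "x \<in> carrier (G n)"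
  then show "\<one>\<^bsub>G n\<^esub> \<otimes>\<^bsub>G n\<^esub> x = x"
    by (auto simp: carrier_G mult_G one_G translate_0)
  obtain a P where aP: "x = (a, P)" "a \<in> A" "P \<in> M n" using x by (auto simp: carrier_G)
  have "(- a, - translate (- a) P) \<otimes>\<^bsub>G n\<^esub> x = \<one>\<^bsub>G n\<^esub>"
    by (simp add: aP mult_G one_G)
  moreover have "(- a, - translate (- a) P) \<in> carrier (G n)"
    using aP by (simp add: carrier_G minus_A minus_M translate_M)
  ultimately show "\<exists>y\<in>carrier (G n). y \<otimes>\<^bsub>G n\<^esub> x = \<one>\<^bsub>G n\<^esub>" by blast
qed

lemma finite_G: "finite (carrier (G n))"
  by (simp add: carrier_G finite_A finite_M)

lemma commutator_G:
  assumes "P \<in> M n" "b \<in> A" "Q \<in> M n"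
  shows "(0, P) \<otimes>\<^bsub>G n\<^esub> (b, Q) \<otimes>\<^bsub>G n\<^esub> inv\<^bsub>G n\<^esub> (0, P) \<otimes>\<^bsub>G n\<^esub> inv\<^bsub>G n\<^esub> (b, Q) = (0, P - translate b P)"
proof -
  interpret group "G n" by (rule group_G)
  let ?x = "(0, P)" and ?y = "(b, Q)" and ?z = "(0, P - translate b P)"
  have c: "?x \<in> carrier (G n)" "?y \<in> carrier (G n)" "?z \<in> carrier (G n)"
    using assms add_M[of P n "- translate b P"] by (simp_all add: carrier_G zero_A minus_M translate_M)
  have "?z \<otimes>\<^bsub>G n\<^esub> (?y \<otimes>\<^bsub>G n\<^esub> ?x) = ?x \<otimes>\<^bsub>G n\<^esub> ?y"
    using assms add_M[OF assms(3) translate_M[OF assms(1,2)]]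
    by (simp add: mult_G translate_0)
  then have "?z = (?x \<otimes>\<^bsub>G n\<^esub> ?y) \<otimes>\<^bsub>G n\<^esub> inv\<^bsub>G n\<^esub> (?y \<otimes>\<^bsub>G n\<^esub> ?x)"
    using c by (metis inv_solve_right m_closed)
  then show ?thesis using c by (simp add: inv_mult_group m_assoc)
qed

lemma commutator_fst:
  assumes "x \<in> carrier (G n)" "y \<in> carrier (G n)"
  shows "fst (x \<otimes>\<^bsub>G n\<^esub> y \<otimes>\<^bsub>G n\<^esub> inv\<^bsub>G n\<^esub> x \<otimes>\<^bsub>G n\<^esub> inv\<^bsub>G n\<^esub> y) = 0"
proof -
  interpret group "G n" by (rule group_G)
  have f: "fst (u \<otimes>\<^bsub>G n\<^esub> v) = fst u + fst v" for u v
    by (cases u; cases v) (simp add: mult_G)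
  have "fst (inv\<^bsub>G n\<^esub> u) = - fst u" if "u \<in> carrier (G n)" for u
    using f[of "inv\<^bsub>G n\<^esub> u" u] that one_G[of n] by (simp add: eq_neg_iff_add_eq_0)
  then show ?thesis using assms by (simp add: f)
qed

text \<open>The subgroup of \<open>M n\<close> of functions of degree less than \<open>d\<close>.\<close>

definition filtration :: "nat \<Rightarrow> nat \<Rightarrow> ((nat \<Rightarrow> 'k) \<times> ((nat \<Rightarrow> 'k) \<Rightarrow> 'k)) set"
  where "filtration n d = {0} \<times> {P \<in> M n. degree_less d P}"

lemma subgroup_filtration: "subgroup (filtration n d) (G n)"
proof (rule group.subgroupI[OF group_G])
  interpret group "G n" by (rule group_G)
  show "filtration n d \<subseteq> carrier (G n)" by (auto simp: filtration_def carrier_G zero_A)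
  have "(0, 0) \<in> filtration n d" using zero_M degree_less_const_0 by (simp add: filtration_def zero_fun_def)
  then show "filtration n d \<noteq> {}" by blast
  {
    fix x assume "x \<in> filtration n d"
    then obtain P where P: "x = (0, P)" "P \<in> M n" "degree_less d P" by (auto simp: filtration_def)
    then have "inv\<^bsub>G n\<^esub> x = (0, - P)"
      using translate_0[OF minus_M] by (intro inv_equality) (simp_all add: mult_G one_G carrier_G zero_A minus_M translate_0)
    then show "inv\<^bsub>G n\<^esub> x \<in> filtration n d"
    proof -
      have "degree_less d (- P)" using degree_less_minus[OF P(3)] by (simp add: fun_Compl_def)
      with \<open>inv\<^bsub>G n\<^esub> x = (0, - P)\<close> show ?thesis using P by (simp add: filtration_def minus_M)
    qed
  next
    fix x y assume "x \<in> filtration n d" "y \<in> filtration n d"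
    then obtain P Q where "x = (0, P)" "P \<in> M n" "degree_less d P" "y = (0, Q)" "Q \<in> M n" "degree_less d Q"
      by (auto simp: filtration_def)
    moreover from this have "degree_less d (P + Q)" using degree_less_add[of d P Q] by (simp add: plus_fun_def)
    ultimately show "x \<otimes>\<^bsub>G n\<^esub> y \<in> filtration n d"
      by (simp add: filtration_def mult_G translate_0 add_M)
  }
qed

lemma lower_central_filtration: "lower_central (G n) (Suc k) \<subseteq> filtration n (n - k)"
proof (induction k)
  case 0
  have "x \<otimes>\<^bsub>G n\<^esub> y \<otimes>\<^bsub>G n\<^esub> inv\<^bsub>G n\<^esub> x \<otimes>\<^bsub>G n\<^esub> inv\<^bsub>G n\<^esub> y \<in> filtration n n"
    if "x \<in> carrier (G n)" "y \<in> carrier (G n)" for x y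
  proof -
    interpret group "G n" by (rule group_G)
    let ?z = "x \<otimes>\<^bsub>G n\<^esub> y \<otimes>\<^bsub>G n\<^esub> inv\<^bsub>G n\<^esub> x \<otimes>\<^bsub>G n\<^esub> inv\<^bsub>G n\<^esub> y"
    have "?z \<in> carrier (G n)" using that by simp
    then have "?z \<in> A \<times> M n" by (simp only: carrier_G)
    moreover have "fst ?z = 0" using commutator_fst that by simp
    ultimately show ?thesis using M_D(4) by (auto simp: filtration_def mem_Times_iff)
  qed
  then show ?case
    by (auto simp: commutator_subgroup_def intro!: group.generate_subgroup_incl[OF group_G _ subgroup_filtration, simplified])
next
  case (Suc k)
  have "x \<otimes>\<^bsub>G n\<^esub> y \<otimes>\<^bsub>G n\<^esub> inv\<^bsub>G n\<^esub> x \<otimes>\<^bsub>G n\<^esub> inv\<^bsub>G n\<^esub> y \<in> filtration n (n - Suc k)"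
    if x: "x \<in> filtration n (n - k)" and y: "y \<in> carrier (G n)" for x y
  proof -
    obtain P where P: "x = (0, P)" "P \<in> M n" "degree_less (n - k) P" using x by (auto simp: filtration_def)
    obtain b Q where Q: "y = (b, Q)" "b \<in> A" "Q \<in> M n" using y by (auto simp: carrier_G)
    have R: "P - translate b P \<in> M n" using add_M[OF P(2) minus_M[OF translate_M[OF P(2) Q(2)]]] by simp
    have "degree_less (n - Suc k) (P - translate b P)"
    proof (cases "n \<le> k")
      case True
      then have "\<forall>x\<in>A. P x = 0" using P by simp
      then have "(P - translate b P) x = 0" if "x \<in> A" for x using that Q by (simp add: translate_def add_A)
      then show ?thesis using degree_less_cong[of "P - translate b P" "\<lambda>x. 0"] degree_less_const_0 by blast
    next
      case False
      then have nk: "n - k = Suc (n - Suc k)" by simp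
      let ?D = "\<lambda>x. P (x + b) - P x"
      have "degree_less (n - Suc k) ?D" using P(3) Q(2) unfolding nk by simp
      then have "degree_less (n - Suc k) (\<lambda>x. ?D x - ?D 0)" by (rule degree_less_normalise)
      then have "degree_less (n - Suc k) (\<lambda>x. - (?D x - ?D 0))" by (rule degree_less_minus)
      moreover have "(P - translate b P) x = - (?D x - ?D 0)" if "x \<in> A" for x
        using that M_D(3)[OF P(2)] by (simp add: translate_def)
      ultimately show ?thesis using degree_less_cong[of "P - translate b P" "\<lambda>x. - (?D x - ?D 0)"] by blast
    qed
    then show ?thesis using commutator_G[OF P(2) Q(2,3)] R P Q by (simp add: filtration_def)
  qed
  then show ?case using Suc
    by (auto simp: commutator_subgroup_def simp del: lower_central.simps(1)
        intro!: group.generate_subgroup_incl[OF group_G _ subgroup_filtration, simplified])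
qed

lemma nilpotent_G: "nilpotent_group (G n)"
proof -
  have "filtration n 0 \<subseteq> {\<one>\<^bsub>G n\<^esub>}"
  proof
    fix x assume "x \<in> filtration n 0"
    then obtain P where P: "x = (0, P)" "P \<in> M n" "\<forall>y\<in>A. P y = 0" by (auto simp: filtration_def)
    then have "P = 0" using M_D(2)[OF P(2)] by (auto simp: fun_eq_iff)
    then show "x \<in> {\<one>\<^bsub>G n\<^esub>}" using P by (simp add: one_G)
  qed
  then have "lower_central (G n) (Suc n) \<subseteq> {\<one>\<^bsub>G n\<^esub>}" using lower_central_filtration[of n n] by auto
  moreover have "\<one>\<^bsub>G n\<^esub> \<in> lower_central (G n) (Suc n)"
    by (simp add: commutator_subgroup_def generate.one)
  ultimately show ?thesis unfolding nilpotent_group_def using group_G by blast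
qed

text \<open>An affine map acts on functions by composition with its inverse.\<close>

definition act :: "nat \<Rightarrow> nat \<Rightarrow> (nat \<Rightarrow> 'k) \<times> ((nat \<Rightarrow> 'k) \<Rightarrow> 'k) \<Rightarrow> (nat \<Rightarrow> 'k) \<times> ((nat \<Rightarrow> 'k) \<Rightarrow> 'k)"
  where "act j h = (\<lambda>(a, P). (aff j h a, pullback (inv_shift j h) (inv_scale h) P))"

lemma pullback_tr:
  assumes "j < p" "h \<in> {1..<p}" "a \<in> A"
  shows "pullback (inv_shift j h) (inv_scale h) (translate a Q) = translate (aff j h a) (pullback (inv_shift j h) (inv_scale h) Q)"
  using assms by (auto simp: pullback_def translate_def fun_eq_iff aff_A add_A aff_add aff_inverse(1))

lemma pullback_add: "pullback k g (P + Q) = pullback k g P + pullback k g Q"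
  by (auto simp: pullback_def fun_eq_iff)

lemma act_hom:
  assumes "j < p" "h \<in> {1..<p}" shows "act j h \<in> hom (G n) (G n)"
proof (rule homI)
  fix x y assume "x \<in> carrier (G n)" "y \<in> carrier (G n)"
  then obtain a P b Q where "x = (a, P)" "a \<in> A" "P \<in> M n" "y = (b, Q)" "b \<in> A" "Q \<in> M n"
    by (auto simp: carrier_G)
  then show "act j h x \<in> carrier (G n)" "act j h (x \<otimes>\<^bsub>G n\<^esub> y) = act j h x \<otimes>\<^bsub>G n\<^esub> act j h y"
    using assms pullback_tr[OF assms] inv_scale(1)[OF assms(2)]
    by (simp_all add: act_def mult_G aff_add pullback_add carrier_G aff_A pullback_M inv_shift_less del: atLeastLessThan_iff)
qed

lemma act_affine: "affine_action p (G n) act"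
  unfolding affine_action_def
proof (intro conjI allI impI ballI)
  fix j h assume "j < p" "h \<in> {1..<p}"
  then show "act j h \<in> hom (G n) (G n)" by (rule act_hom)
next
  fix x assume "x \<in> carrier (G n)"
  then obtain a P where x: "x = (a, P)" "a \<in> A" "P \<in> M n" by (auto simp: carrier_G)
  have 1: "(1::nat) \<in> {1..<p}" using p_pos by simp
  have "P (aff (inv_shift 0 1) (inv_scale 1) y) = P y" if "y \<in> A" for y
    using aff_inverse(1)[OF p_pos(1) 1 that] aff_id[OF that] by simp
  then have "pullback (inv_shift 0 1) (inv_scale 1) P = P"
    using M_D(2)[OF x(3)] by (auto simp: pullback_def fun_eq_iff)
  then show "act 0 1 x = x" using x aff_id by (simp add: act_def)
next
  fix j h k g x assume jh: "j < p" "h \<in> {1..<p}" and kg: "k < p" "g \<in> {1..<p}" and "x \<in> carrier (G n)"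
  then obtain a P where x: "x = (a, P)" "a \<in> A" "P \<in> M n" by (auto simp: carrier_G)
  let ?l = "(j + k * h) mod p" and ?m = "h * g mod p"
  have lm: "?l < p" "?m \<in> {1..<p}" using p_pos mult_mod_prime_range[OF prime_p] jh kg by auto
  have "aff (inv_shift k g) (inv_scale g) (aff (inv_shift j h) (inv_scale h) y) = aff (inv_shift ?l ?m) (inv_scale ?m) y" if y: "y \<in> A" for y
  proof -
    let ?u = "aff (inv_shift k g) (inv_scale g) (aff (inv_shift j h) (inv_scale h) y)"
    have u: "?u \<in> A" using y aff_A by blast
    have "aff ?l ?m ?u = aff j h (aff k g ?u)" using aff_aff[OF jh(2)] by simp
    also have "\<dots> = y" using aff_inverse(2)[OF kg] aff_inverse(2)[OF jh] y aff_A by simp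
    finally have "aff ?l ?m ?u = y" .
    then show ?thesis using aff_inverse(1)[OF lm u] by simp
  qed
  then have "pullback (inv_shift j h) (inv_scale h) (pullback (inv_shift k g) (inv_scale g) P) = pullback (inv_shift ?l ?m) (inv_scale ?m) P"
    unfolding pullback_def by (intro ext) (simp add: aff_A)
  then show "act j h (act k g x) = act ?l ?m x"
    using x aff_aff[OF jh(2)] by (simp add: act_def)
next
  fix j h assume jh: "j < p" "h \<in> {1..<p}" and fx: "\<forall>x\<in>carrier (G n). act j h x = x"
  \<comment> \<open>The first unit vector is moved by every non-trivial affine map.\<close>
  define a :: "nat \<Rightarrow> 'k" where "a = (\<lambda>i. if i = 1 then 1 else 0)"
  have "a \<in> A" using p_pos by (intro A_I) (auto simp: a_def zero_S one_S)
  then have "act j h (a, 0) = (a, 0)" using fx by (simp add: carrier_G zero_M)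
  then have "aff j h a 1 = a 1" by (simp add: act_def)
  then have e: "\<omega> ^ j * (if h = 1 then 1 else 0) = 1" using jh p_pos by (simp add: aff_def a_def)
  then show "h = 1" by (auto split: if_splits)
  from e have "\<omega> ^ j = 1" by (auto split: if_splits)
  then show "j = 0" using omega_pow_eq_1_iff jh by (auto dest: dvd_imp_le)
qed

lemma act_pullback_fixed:
  assumes "P \<in> M n" "j < p" "h \<in> {1..<p}" "pullback (inv_shift j h) (inv_scale h) P = P" "x \<in> A"
  shows "P (aff j h x) = P x"
proof -
  have "P (aff j h x) = pullback (inv_shift j h) (inv_scale h) P (aff j h x)" using assms by simp
  also have "\<dots> = P (aff (inv_shift j h) (inv_scale h) (aff j h x))" using assms(5) by (simp add: pullback_def aff_A)
  also have "\<dots> = P x" using aff_inverse(1)[OF assms(2,3,5)] by simp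
  finally show ?thesis .
qed

lemma F_fixed:
  assumes "x \<in> carrier (G n)" "\<forall>j<p. act j 1 x = x"
  shows "x = \<one>\<^bsub>G n\<^esub>"
proof -
  have 1: "(1::nat) \<in> {1..<p}" using p_pos by simp
  obtain a P where x: "x = (a, P)" "a \<in> A" "P \<in> M n" using assms by (auto simp: carrier_G)
  have fx: "aff j 1 a = a" "pullback (inv_shift j 1) (inv_scale 1) P = P" if "j < p" for j
    using assms(2) that x by (auto simp: act_def)
  have "a i = 0" for i
  proof (cases "i \<in> {1..<p}")
    case True
    have "\<omega> ^ i * a i = a i" using fun_cong[OF fx(1)[of 1], of i] True p_pos by (simp add: aff_def)
    moreover have "\<not> p dvd i" using True by (auto dest: dvd_imp_le)
    ultimately show ?thesis using omega_pow_eq_1_iff by simp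
  qed (use x A_0 in auto)
  then have "a = 0" by (simp add: fun_eq_iff)
  moreover have "P y = 0" for y
  proof (cases "y \<in> A")
    case True
    have "(\<Sum>j<p. P (aff j 1 y + 0) - P 0) = 0"
      using M_D(5)[OF x(3)] True zero_A unfolding kernel_sum_zero_def by blast
    moreover have "P (aff j 1 y) = P y" if "j < p" for j
      using act_pullback_fixed[OF x(3) that 1 fx(2)[OF that] True] .
    ultimately show ?thesis using M_D(3)[OF x(3)] p_neq_0 by simp
  qed (use x M_D(2) in auto)
  then have "P = 0" by (simp add: fun_eq_iff)
  ultimately show ?thesis using x by (simp add: one_G)
qed

text \<open>For an \<open>H\<close>-invariant \<open>P\<close> the sum over \<open>h\<close> of \<open>P (aff 1 h y)\<close> runs over the images of \<open>y\<close> under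
  the non-trivial elements of \<open>F\<close>, because \<open>(0, inv_scale h)\<close> composed with \<open>(1, h)\<close> is the translation
  \<open>(inv_scale h, 1)\<close>.\<close>

lemma H_fixed_sum:
  assumes P: "P \<in> M n" and fx: "\<And>h x. h \<in> {1..<p} \<Longrightarrow> x \<in> A \<Longrightarrow> P (aff 0 h x) = P x" and y: "y \<in> A"
  shows "(\<Sum>h\<in>{1..<p}. P (aff 1 h y)) = - P y"
proof -
  have "P (aff 1 h y) = P (aff (inv_scale h) 1 y)" if h: "h \<in> {1..<p}" for h
  proof -
    have "aff 0 (inv_scale h) (aff 1 h y) = aff (inv_scale h) 1 y"
      using inv_scale[OF h] by (simp add: aff_aff del: atLeastLessThan_iff)
         (auto simp: aff_aff)
    then show ?thesis using fx[OF inv_scale(1)[OF h] aff_A[OF y, of 1 h]] by simp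
  qed
  then have "(\<Sum>h\<in>{1..<p}. P (aff 1 h y)) = (\<Sum>h\<in>{1..<p}. P (aff (inv_scale h) 1 y))" by simp
  also have "\<dots> = (\<Sum>j\<in>{1..<p}. P (aff j 1 y))"
    by (rule sum.reindex_bij_witness[of _ inv_scale inv_scale]) (use inv_scale in auto)
  also have "\<dots> = (\<Sum>j<p. P (aff j 1 y)) - P (aff 0 1 y)"
  proof -
    have "{..<p} = insert 0 {1..<p}" using p_pos by auto
    then show ?thesis by simp
  qed
  also have "(\<Sum>j<p. P (aff j 1 y)) = (\<Sum>j<p. P (aff j 1 y + 0) - P 0)"
    using M_D(3)[OF P] by simp
  also have "\<dots> = 0" using M_D(5)[OF P] y zero_A unfolding kernel_sum_zero_def by blast
  finally show ?thesis using aff_id y by simp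
qed

lemma H_fixed_translate:
  assumes P: "P \<in> M n" and fx: "\<And>h x. h \<in> {1..<p} \<Longrightarrow> x \<in> A \<Longrightarrow> P (aff 0 h x) = P x" and c: "c \<in> S"
  shows "translate (const_vec c) P = P"
proof
  fix x
  show "translate (const_vec c) P x = P x"
  proof (cases "x \<in> A")
    case True
    have "(\<Sum>h\<in>{1..<p}. P (aff 1 h (x + const_vec c) + 0) - P (aff 1 h (const_vec c) + 0) - P (aff 1 h x + 0) + P 0) = 0"
      using M_D(6)[OF P] True zero_A c p_pos unfolding complement_sum_zero_def by blast
    then have "(\<Sum>h\<in>{1..<p}. P (aff 1 h (x + const_vec c))) - (\<Sum>h\<in>{1..<p}. P (aff 1 h (const_vec c)))
       - (\<Sum>h\<in>{1..<p}. P (aff 1 h x)) = 0"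
      using M_D(3)[OF P] by (simp add: sum_subtractf)
    then have "- P (x + const_vec c) + P (const_vec c) + P x = 0"
      using H_fixed_sum[OF P fx] True c const_vec_A add_A by simp
    then show ?thesis using True by (simp add: translate_def algebra_simps)
  qed (use P M_D(2) in \<open>auto simp: translate_def\<close>)
qed

lemma H_fixed_structure:
  assumes "x \<in> carrier (G n)" "\<forall>h\<in>{1..<p}. act 0 h x = x"
  obtains c P where "x = (const_vec c, P)" "c \<in> S" "P \<in> M n"
    "\<And>h y. h \<in> {1..<p} \<Longrightarrow> y \<in> A \<Longrightarrow> P (aff 0 h y) = P y"
proof -
  obtain a P where x: "x = (a, P)" "a \<in> A" "P \<in> M n" using assms by (auto simp: carrier_G)
  have fx: "aff 0 h a = a" "pullback (inv_shift 0 h) (inv_scale h) P = P" if "h \<in> {1..<p}" for h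
    using assms(2) that x by (auto simp: act_def)
  have "a = const_vec (a 1)"
  proof
    fix i show "a i = const_vec (a 1) i"
    proof (cases "i \<in> {1..<p}")
      case True
      then show ?thesis using fun_cong[OF fx(1)[OF True], of 1] p_pos by (simp add: aff_def const_vec_def)
    next
      case False then show ?thesis using A_0[OF x(2)] by (simp only: const_vec_def if_False)
    qed
  qed
  moreover have "P (aff 0 h y) = P y" if "h \<in> {1..<p}" "y \<in> A" for h y
    using act_pullback_fixed[OF x(3) p_pos(1) that(1) fx(2) that(2)] that by blast
  ultimately show thesis using that[of "a 1" P] x A_S by metis
qed

lemma H_fixed_commute:
  assumes "x \<in> carrier (G n)" "y \<in> carrier (G n)" "\<forall>h\<in>{1..<p}. act 0 h x = x" "\<forall>h\<in>{1..<p}. act 0 h y = y"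
  shows "x \<otimes>\<^bsub>G n\<^esub> y = y \<otimes>\<^bsub>G n\<^esub> x"
proof -
  obtain c P where x: "x = (const_vec c, P)" "c \<in> S" "P \<in> M n"
    "\<And>h y. h \<in> {1..<p} \<Longrightarrow> y \<in> A \<Longrightarrow> P (aff 0 h y) = P y"
    using H_fixed_structure[OF assms(1,3)] by blast
  obtain d Q where y: "y = (const_vec d, Q)" "d \<in> S" "Q \<in> M n"
    "\<And>h y. h \<in> {1..<p} \<Longrightarrow> y \<in> A \<Longrightarrow> Q (aff 0 h y) = Q y"
    using H_fixed_structure[OF assms(2,4)] by blast
  show ?thesis using H_fixed_translate[OF x(3,4) y(2)] H_fixed_translate[OF y(3,4) x(2)] x(1) y(1)
    by (simp add: mult_G add.commute)
qed

end

section \<open>Monomials with vanishing line sums\<close>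

lemma prod_add_minus_prod:
  fixes \<alpha> \<beta> :: "'i \<Rightarrow> 'c::comm_ring_1"
  assumes "finite I"
  shows "(\<Prod>i\<in>I. \<alpha> i + \<beta> i) - (\<Prod>i\<in>I. \<beta> i) = (\<Sum>Y\<in>Pow I - {{}}. (\<Prod>i\<in>Y. \<alpha> i) * (\<Prod>i\<in>I - Y. \<beta> i))"
proof -
  have "Pow I = insert {} (Pow I - {{}})" by auto
  then have "(\<Prod>i\<in>I. \<alpha> i + \<beta> i) = (\<Sum>Y\<in>insert {} (Pow I - {{}}). (\<Prod>i\<in>Y. \<alpha> i) * (\<Prod>i\<in>I - Y. \<beta> i))"
    using prod_add[OF assms, of \<alpha> \<beta>] by simp
  also have "\<dots> = (\<Prod>i\<in>I. \<beta> i) + (\<Sum>Y\<in>Pow I - {{}}. (\<Prod>i\<in>Y. \<alpha> i) * (\<Prod>i\<in>I - Y. \<beta> i))"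
    using assms by (subst sum.insert) auto
  finally show ?thesis by simp
qed

text \<open>The second difference of a product collects the terms that contain factors of both kinds.\<close>

lemma prod_second_difference:
  fixes \<alpha> \<beta> \<gamma> :: "'i \<Rightarrow> 'c::comm_ring_1"
  assumes "finite I"
  shows "(\<Prod>i\<in>I. \<alpha> i + \<gamma> i + \<beta> i) - (\<Prod>i\<in>I. \<gamma> i + \<beta> i) - (\<Prod>i\<in>I. \<alpha> i + \<beta> i) + (\<Prod>i\<in>I. \<beta> i) =
    (\<Sum>Y\<in>Pow I - {{}}. \<Sum>C\<in>Pow (I - Y) - {{}}.
       (\<Prod>i\<in>Y. \<alpha> i) * (\<Prod>i\<in>C. \<gamma> i) * (\<Prod>i\<in>I - Y - C. \<beta> i))"
proof -
  have "(\<Prod>i\<in>I. \<alpha> i + \<gamma> i + \<beta> i) - (\<Prod>i\<in>I. \<gamma> i + \<beta> i) - (\<Prod>i\<in>I. \<alpha> i + \<beta> i) + (\<Prod>i\<in>I. \<beta> i) =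
    ((\<Prod>i\<in>I. \<alpha> i + (\<gamma> i + \<beta> i)) - (\<Prod>i\<in>I. \<gamma> i + \<beta> i)) - ((\<Prod>i\<in>I. \<alpha> i + \<beta> i) - (\<Prod>i\<in>I. \<beta> i))"
    by (simp add: add.assoc)
  also have "\<dots> = (\<Sum>Y\<in>Pow I - {{}}. (\<Prod>i\<in>Y. \<alpha> i) * ((\<Prod>i\<in>I - Y. \<gamma> i + \<beta> i) - (\<Prod>i\<in>I - Y. \<beta> i)))"
    unfolding prod_add_minus_prod[OF assms] sum_subtractf[symmetric] right_diff_distrib ..
  also have "\<dots> = (\<Sum>Y\<in>Pow I - {{}}. \<Sum>C\<in>Pow (I - Y) - {{}}.
       (\<Prod>i\<in>Y. \<alpha> i) * (\<Prod>i\<in>C. \<gamma> i) * (\<Prod>i\<in>I - Y - C. \<beta> i))"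
  proof (rule sum.cong[OF refl])
    fix Y
    have "finite (I - Y)" using assms by simp
    from prod_add_minus_prod[OF this, of \<gamma> \<beta>]
    show "(\<Prod>i\<in>Y. \<alpha> i) * ((\<Prod>i\<in>I - Y. \<gamma> i + \<beta> i) - (\<Prod>i\<in>I - Y. \<beta> i)) =
      (\<Sum>C\<in>Pow (I - Y) - {{}}. (\<Prod>i\<in>Y. \<alpha> i) * (\<Prod>i\<in>C. \<gamma> i) * (\<Prod>i\<in>I - Y - C. \<beta> i))"
      by (simp add: sum_distrib_left mult.assoc)
  qed
  finally show ?thesis .
qed

lemma lower_central_trivial_mono:
  assumes "group G" "lower_central G m = {\<one>\<^bsub>G\<^esub>}" "m \<le> k"
  shows "lower_central G k = {\<one>\<^bsub>G\<^esub>}"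
  using assms(3)
proof (induction k rule: dec_induct)
  case base then show ?case by (rule assms(2))
next
  case (step k)
  interpret group G by fact
  have "(\<Union>h\<in>{\<one>\<^bsub>G\<^esub>}. \<Union>k\<in>carrier G. {h \<otimes>\<^bsub>G\<^esub> k \<otimes>\<^bsub>G\<^esub> inv\<^bsub>G\<^esub> h \<otimes>\<^bsub>G\<^esub> inv\<^bsub>G\<^esub> k}) = {\<one>\<^bsub>G\<^esub>}"
    by auto
  then show ?case using step by (simp add: commutator_subgroup_def generate_one)
qed

lemma nilpotency_class_greater:
  assumes "nilpotent_group G" "lower_central G k \<noteq> {\<one>\<^bsub>G\<^esub>}"
  shows "k < nilpotency_class G"
proof -
  obtain m where m: "group G" "lower_central G m = {\<one>\<^bsub>G\<^esub>}"
    using assms(1) unfolding nilpotent_group_def by blast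
  have trivial: "lower_central G (nilpotency_class G) = {\<one>\<^bsub>G\<^esub>}"
    unfolding nilpotency_class_def by (rule LeastI[of _ m]) (rule m(2))
  show ?thesis
  proof (rule ccontr)
    assume "\<not> ?thesis"
    then have "nilpotency_class G \<le> k" by simp
    from lower_central_trivial_mono[OF m(1) trivial this] show False using assms(2) by contradiction
  qed
qed

text \<open>If finitely many maps have fewer fibres altogether than there are points, then some non-zero
  function sums to zero over each fibre: two different functions have the same fibre sums by the pigeonhole
  principle, and their difference is as required.\<close>

lemma zero_fibre_sums_exist:
  fixes \<kappa> :: "'j \<Rightarrow> 't \<Rightarrow> 'v" and S :: "'k::ab_group_add set"
  assumes D: "finite D" and J: "finite J" and S: "finite S" "0 \<in> S" "z \<in> S" "z \<noteq> 0"
    and add: "\<And>x y. x \<in> S \<Longrightarrow> y \<in> S \<Longrightarrow> x + y \<in> S" and minus: "\<And>x. x \<in> S \<Longrightarrow> - x \<in> S"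
    and card: "(\<Sum>j\<in>J. card (\<kappa> j ` D)) < card D"
  shows "\<exists>f. (\<forall>t\<in>D. f t \<in> S) \<and> (\<exists>t\<in>D. f t \<noteq> 0) \<and> (\<forall>j\<in>J. \<forall>v. (\<Sum>t\<in>{t \<in> D. \<kappa> j t = v}. f t) = 0)"
proof -
  define T where "T = Sigma J (\<lambda>j. \<kappa> j ` D)"
  define \<Psi> where "\<Psi> f = restrict (\<lambda>(j, v). \<Sum>t\<in>{t \<in> D. \<kappa> j t = v}. f t) T" for f :: "'t \<Rightarrow> 'k"
  have finT: "finite T" using D J by (simp add: T_def)
  have cT: "card T < card D" using card D J by (simp add: T_def)
  have sumS: "sum f I \<in> S" if "\<And>i. i \<in> I \<Longrightarrow> f i \<in> S" for f :: "'t \<Rightarrow> 'k" and I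
    using that by (induction I rule: infinite_finite_induct) (auto intro: S add)
  have "\<Psi> \<in> (D \<rightarrow>\<^sub>E S) \<rightarrow> (T \<rightarrow>\<^sub>E S)"
    by (auto simp: \<Psi>_def PiE_iff split: prod.split intro!: sumS)
  moreover have "card (T \<rightarrow>\<^sub>E S) < card (D \<rightarrow>\<^sub>E S)"
  proof -
    have "card {0, z} \<le> card S" using S by (intro card_mono) auto
    then have "1 < card S" using S(4) by simp
    then show ?thesis using cT D finT by (simp add: card_funcsetE power_strict_increasing)
  qed
  moreover have "finite (T \<rightarrow>\<^sub>E S)" using finT S by (intro finite_PiE) auto
  ultimately have "\<not> inj_on \<Psi> (D \<rightarrow>\<^sub>E S)"
    by (metis card_inj_on_le funcset_image linorder_not_less)
  then obtain f g where fg: "f \<in> D \<rightarrow>\<^sub>E S" "g \<in> D \<rightarrow>\<^sub>E S" "\<Psi> f = \<Psi> g" "f \<noteq> g"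
    unfolding inj_on_def by blast
  have "\<exists>t\<in>D. f t \<noteq> g t" using fg(1,2,4) by (meson PiE_ext)
  moreover have "f t - g t \<in> S" if "t \<in> D" for t
    using add[of "f t" "- g t"] minus fg that by auto
  moreover have "(\<Sum>t\<in>{t \<in> D. \<kappa> j t = v}. f t - g t) = 0" if j: "j \<in> J" for j v
  proof (cases "v \<in> \<kappa> j ` D")
    case True
    then have "(j, v) \<in> T" using j by (simp add: T_def)
    then have "(\<Sum>t\<in>{t \<in> D. \<kappa> j t = v}. f t) = (\<Sum>t\<in>{t \<in> D. \<kappa> j t = v}. g t)"
      using fun_cong[OF fg(3), of "(j, v)"] by (simp add: \<Psi>_def)
    then show ?thesis by (simp add: sum_subtractf)
  next
    case False
    then have empty: "{t \<in> D. \<kappa> j t = v} = {}" by auto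
    show ?thesis unfolding empty by simp
  qed
  ultimately show ?thesis by (intro exI[of _ "\<lambda>t. f t - g t"]) auto
qed

lemma sum_zero_of_fibre_sums:
  fixes f \<Phi> :: "'t \<Rightarrow> 'k::comm_ring_1"
  assumes "finite D" "\<And>v. (\<Sum>t\<in>{t \<in> D. \<kappa> t = v}. f t) = 0"
    and "\<And>t t'. t \<in> D \<Longrightarrow> t' \<in> D \<Longrightarrow> \<kappa> t = \<kappa> t' \<Longrightarrow> \<Phi> t = \<Phi> t'"
  shows "(\<Sum>t\<in>D. f t * \<Phi> t) = 0"
proof -
  have "(\<Sum>t\<in>D. f t * \<Phi> t) = (\<Sum>v\<in>\<kappa> ` D. \<Sum>t\<in>{t \<in> D. \<kappa> t = v}. f t * \<Phi> t)"
    using assms(1) by (rule sum.image_gen)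
  also have "\<dots> = 0"
  proof (rule sum.neutral, rule ballI)
    fix v assume "v \<in> \<kappa> ` D"
    then obtain s where s: "s \<in> D" "v = \<kappa> s" by blast
    have const: "\<Phi> t = \<Phi> s" if "t \<in> {t \<in> D. \<kappa> t = v}" for t
      using that s by (intro assms(3)) auto
    have "(\<Sum>t\<in>{t \<in> D. \<kappa> t = v}. f t * \<Phi> t) = (\<Sum>t\<in>{t \<in> D. \<kappa> t = v}. f t) * \<Phi> s"
      unfolding sum_distrib_right by (intro sum.cong refl arg_cong[of _ _ "(*) (f _)"] const)
    then show "(\<Sum>t\<in>{t \<in> D. \<kappa> t = v}. f t * \<Phi> t) = 0" using assms(2) by simp
  qed
  finally show ?thesis .
qed

context coefficient_field
begin

lemma degree_less_sum: "finite Box \<Longrightarrow> (\<And>t. t \<in> Box \<Longrightarrow> degree_less m (P t)) \<Longrightarrow> degree_less m (\<lambda>x. \<Sum>t\<in>Box. P t x)"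
proof (induction Box rule: finite_induct)
  case empty then show ?case by (simp add: degree_less_const_0)
next
  case (insert t Box)
  then have "degree_less m (\<lambda>x. P t x + (\<Sum>t\<in>Box. P t x))" by (intro degree_less_add) auto
  then show ?case using insert by simp
qed

lemma degree_less_mult_coord: "degree_less m Q \<Longrightarrow> degree_less (Suc m) (\<lambda>x. x i * Q x)"
proof (induction m arbitrary: Q)
  case 0
  then show ?case by (auto simp: add_A)
next
  case (Suc m)
  have "degree_less (Suc m) (\<lambda>x. (x + u) i * Q (x + u) - x i * Q x)" if u: "u \<in> A" for u
  proof -
    have "degree_less (Suc m) (\<lambda>x. x i * (Q (x + u) - Q x))"
      using Suc.prems u by (intro Suc.IH) (simp only: degree_less.simps)
    moreover have "degree_less (Suc m) (\<lambda>x. u i * Q (x + u))"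
      using degree_less_scale[OF degree_less_shift[OF Suc.prems u]] .
    ultimately have "degree_less (Suc m) (\<lambda>x. x i * (Q (x + u) - Q x) + u i * Q (x + u))" by (rule degree_less_add)
    moreover have "(\<lambda>x. (x + u) i * Q (x + u) - x i * Q x) = (\<lambda>x. x i * (Q (x + u) - Q x) + u i * Q (x + u))"
      by (intro ext) (simp add: algebra_simps)
    ultimately show ?thesis by (simp only:)
  qed
  then show ?case by (subst degree_less.simps(2)) blast
qed

lemma degree_less_monomial: "finite I \<Longrightarrow> degree_less (Suc (card I)) (\<lambda>x. \<Prod>w\<in>I. x (t w))"
proof (induction I rule: finite_induct)
  case empty then show ?case by simp
next
  case (insert w I)
  show ?case using degree_less_mult_coord[OF insert.IH, of "t w"] insert.hyps by (simp del: degree_less.simps)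
qed

text \<open>The polynomial function with coefficient \<open>f t\<close> at the monomial \<open>x (t 0) * \<dots> * x (t (n - 1))\<close>.\<close>

definition poly_of :: "(nat \<Rightarrow> nat) set \<Rightarrow> nat \<Rightarrow> ((nat \<Rightarrow> nat) \<Rightarrow> 'k) \<Rightarrow> (nat \<Rightarrow> 'k) \<Rightarrow> 'k"
  where "poly_of Box n f = (\<lambda>x. if x \<in> A then \<Sum>t\<in>Box. f t * (\<Prod>w<n. x (t w)) else 0)"

text \<open>The map belonging to \<open>Y\<close> and \<open>w\<close>. Its value at \<open>t\<close> records the ratios of the entries in \<open>Y\<close>
  modulo \<open>p\<close>, the sum of the entries at \<open>w\<close> and in \<open>Y\<close> modulo \<open>p\<close>, and the remaining entries. The ratios are
  taken with respect to the entry at \<open>Min Y\<close>; as its own ratio is \<open>1\<close>, the value \<open>0\<close> is stored there.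
  This is what leaves only \<open>n - 1\<close> free entries.\<close>

definition line_class :: "nat \<Rightarrow> nat set \<Rightarrow> nat \<Rightarrow> (nat \<Rightarrow> nat) \<Rightarrow> nat \<Rightarrow> nat"
  where "line_class n Y w t = (\<lambda>i\<in>{..<n}. if i = Min Y then 0
     else if i \<in> Y then t i * inv_scale (t (Min Y)) mod p
     else if i = w then (t w + (\<Sum>y\<in>Y. t y)) mod p else t i)"

lemma line_class_eqD:
  assumes Y: "Y \<subseteq> {..<n}" "Y \<noteq> {}" and w: "w < n" "w \<notin> Y" and eq: "line_class n Y w t = line_class n Y w t'"
    and t: "\<And>i. i < n \<Longrightarrow> t i \<in> {1..<p}" and t': "\<And>i. i < n \<Longrightarrow> t' i \<in> {1..<p}"
  shows "\<And>i. i < n \<Longrightarrow> i \<notin> Y \<Longrightarrow> i \<noteq> w \<Longrightarrow> t i = t' i"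
    "[t w + (\<Sum>y\<in>Y. t y) = t' w + (\<Sum>y\<in>Y. t' y)] (mod p)"
    "\<exists>g\<in>{1..<p}. \<forall>i\<in>Y. t' i = g * t i mod p"
proof -
  have fY: "finite Y" using Y finite_subset by blast
  define y0 where "y0 = Min Y"
  have y0: "y0 \<in> Y" "y0 < n" using Min_in[OF fY Y(2)] Y(1) by (auto simp: y0_def)
  have k: "line_class n Y w t i = line_class n Y w t' i" for i using eq by simp
  show "t i = t' i" if "i < n" "i \<notin> Y" "i \<noteq> w" for i
    using k[of i] that y0 by (auto simp: line_class_def y0_def[symmetric] split: if_splits)
  show "[t w + (\<Sum>y\<in>Y. t y) = t' w + (\<Sum>y\<in>Y. t' y)] (mod p)"
    using k[of w] w y0 by (auto simp: line_class_def y0_def[symmetric] cong_def split: if_splits)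
  let ?u = "inv_scale (t y0)" and ?u' = "inv_scale (t' y0)"
  have u: "[?u * t y0 = 1] (mod p)" "[t' y0 * ?u' = 1] (mod p)"
    using inv_scale[OF t[OF y0(2)]] inv_scale[OF t'[OF y0(2)]] p_pos by (simp_all add: cong_def)
  define g where "g = t' y0 * ?u mod p"
  have g: "g \<in> {1..<p}" unfolding g_def
    using mult_mod_prime_range[OF prime_p] t'[OF y0(2)] inv_scale(1)[OF t[OF y0(2)]] by blast
  have "t' i = g * t i mod p" if i: "i \<in> Y" for i
  proof -
    have il: "i < n" using i Y by auto
    have "[t i * ?u = t' i * ?u'] (mod p)"
    proof (cases "i = y0")
      case True
      then show ?thesis using u by (metis cong_sym cong_trans mult.commute)
    next
      case False
      then show ?thesis using k[of i] il i by (simp add: line_class_def y0_def[symmetric] cong_def)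
    qed
    then have "[t' y0 * (t i * ?u) = t' y0 * (t' i * ?u')] (mod p)" by (rule cong_scalar_left)
    moreover have "[t' i * (t' y0 * ?u') = t' i * 1] (mod p)" using u(2) by (rule cong_scalar_left)
    moreover have "[t' y0 * ?u * t i = g * t i] (mod p)"
      unfolding g_def by (intro cong_scalar_right) (simp add: cong_def)
    ultimately have "[g * t i = t' i] (mod p)"
      by (simp add: cong_def mult.assoc mult.left_commute mult.commute)
    then show ?thesis using t'[OF il] by (simp add: cong_def)
  qed
  then show "\<exists>g\<in>{1..<p}. \<forall>i\<in>Y. t' i = g * t i mod p" using g by blast
qed

text \<open>The index set \<open>Box\<close> consists of tuples of length \<open>n\<close> with entries in \<open>1, \<dots>, p - 1\<close> and sum less than \<open>p\<close>,
  and the coefficients \<open>f\<close> sum to zero over every fibre of \<open>line_class n Y w\<close>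
  for every non-empty set \<open>Y\<close> of positions and every position \<open>w\<close> outside \<open>Y\<close>.\<close>

context
  fixes Box :: "(nat \<Rightarrow> nat) set" and n :: nat and f :: "(nat \<Rightarrow> nat) \<Rightarrow> 'k"
  assumes n_pos: "0 < n" and finite_Box: "finite Box"
    and Box_range: "\<And>t i. t \<in> Box \<Longrightarrow> i < n \<Longrightarrow> t i \<in> {1..<p}"
    and Box_sum: "\<And>t. t \<in> Box \<Longrightarrow> (\<Sum>i<n. t i) < p"
    and f_S: "\<And>t. t \<in> Box \<Longrightarrow> f t \<in> S"
    and f_fibre: "\<And>Y w v. Y \<subseteq> {..<n} \<Longrightarrow> Y \<noteq> {} \<Longrightarrow> w < n \<Longrightarrow> w \<notin> Y \<Longrightarrow>
      (\<Sum>t\<in>{t \<in> Box. line_class n Y w t = v}. f t) = 0"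
begin

lemma aff_at: "t \<in> Box \<Longrightarrow> i < n \<Longrightarrow> aff j h a (t i) = \<omega> ^ (j * t i) * a (h * t i mod p)"
  using Box_range[of t i] by (simp add: aff_def)

text \<open>Every term of the expanded difference depends on \<open>j\<close> through a factor \<open>\<omega> ^ (j * m)\<close> with \<open>0 < m < p\<close>,
  where \<open>m\<close> is a non-empty partial sum of a tuple; these factors sum to zero.\<close>

lemma poly_of_kernel_sum_zero: "kernel_sum_zero (poly_of Box n f)"
  unfolding kernel_sum_zero_def
proof (intro ballI)
  fix a b assume ab: "a \<in> A" "b \<in> A"
  let ?I = "{..<n}"
  have inner: "(\<Sum>j<p. (\<Prod>w<n. (aff j 1 a + b) (t w)) - (\<Prod>w<n. b (t w))) = 0" if t: "t \<in> Box" for t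
  proof -
    have "(\<Prod>w<n. (aff j 1 a + b) (t w)) - (\<Prod>w<n. b (t w)) =
      (\<Sum>Y\<in>Pow ?I - {{}}. \<omega> ^ (j * (\<Sum>w\<in>Y. t w)) * ((\<Prod>w\<in>Y. a (t w)) * (\<Prod>w\<in>?I - Y. b (t w))))" for j
    proof -
      have "(\<Prod>w<n. (aff j 1 a + b) (t w)) - (\<Prod>w<n. b (t w)) =
        (\<Sum>Y\<in>Pow ?I - {{}}. (\<Prod>w\<in>Y. aff j 1 a (t w)) * (\<Prod>w\<in>?I - Y. b (t w)))"
        using prod_add_minus_prod[of ?I "\<lambda>w. aff j 1 a (t w)" "\<lambda>w. b (t w)"] by simp
      also have "\<dots> = (\<Sum>Y\<in>Pow ?I - {{}}. \<omega> ^ (j * (\<Sum>w\<in>Y. t w)) * ((\<Prod>w\<in>Y. a (t w)) * (\<Prod>w\<in>?I - Y. b (t w))))"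
      proof (rule sum.cong[OF refl])
        fix Y assume Y: "Y \<in> Pow ?I - {{}}"
        have "(\<Prod>w\<in>Y. aff j 1 a (t w)) = (\<Prod>w\<in>Y. \<omega> ^ (j * t w) * a (t w))"
          using Y t Box_range by (intro prod.cong) (auto simp: aff_at)
        also have "\<dots> = \<omega> ^ (j * (\<Sum>w\<in>Y. t w)) * (\<Prod>w\<in>Y. a (t w))"
          by (simp add: prod.distrib power_sum sum_distrib_left)
        finally show "(\<Prod>w\<in>Y. aff j 1 a (t w)) * (\<Prod>w\<in>?I - Y. b (t w)) =
          \<omega> ^ (j * (\<Sum>w\<in>Y. t w)) * ((\<Prod>w\<in>Y. a (t w)) * (\<Prod>w\<in>?I - Y. b (t w)))"
          by (simp add: mult.assoc)
      qed
      finally show ?thesis .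
    qed
    then have "(\<Sum>j<p. (\<Prod>w<n. (aff j 1 a + b) (t w)) - (\<Prod>w<n. b (t w))) =
      (\<Sum>j<p. \<Sum>Y\<in>Pow ?I - {{}}. \<omega> ^ (j * (\<Sum>w\<in>Y. t w)) * ((\<Prod>w\<in>Y. a (t w)) * (\<Prod>w\<in>?I - Y. b (t w))))"
      by simp
    also have "\<dots> = (\<Sum>Y\<in>Pow ?I - {{}}. \<Sum>j<p. \<omega> ^ (j * (\<Sum>w\<in>Y. t w)) * ((\<Prod>w\<in>Y. a (t w)) * (\<Prod>w\<in>?I - Y. b (t w))))"
      by (rule sum.swap)
    also have "\<dots> = 0"
    proof (rule sum.neutral, rule ballI)
      fix Y assume Y: "Y \<in> Pow ?I - {{}}"
      then have fY: "finite Y" using finite_subset by blast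
      have "(\<Sum>w\<in>Y. t w) \<le> (\<Sum>w<n. t w)" using Y by (intro sum_mono2) auto
      moreover have "(\<Sum>w\<in>Y. t w) \<noteq> 0"
        using Y fY Box_range[OF t] by (fastforce simp: sum_eq_0_iff)
      ultimately have "\<not> p dvd (\<Sum>w\<in>Y. t w)"
        using Box_sum[OF t] by (auto dest!: dvd_imp_le)
      from sum_omega_pow[OF this]
      show "(\<Sum>j<p. \<omega> ^ (j * (\<Sum>w\<in>Y. t w)) * ((\<Prod>w\<in>Y. a (t w)) * (\<Prod>w\<in>?I - Y. b (t w)))) = 0"
        by (simp add: sum_distrib_right[symmetric])
    qed
    finally show ?thesis .
  qed
  have "(\<Sum>j<p. poly_of Box n f (aff j 1 a + b) - poly_of Box n f b) =
    (\<Sum>j<p. \<Sum>t\<in>Box. f t * ((\<Prod>w<n. (aff j 1 a + b) (t w)) - (\<Prod>w<n. b (t w))))"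
    using ab aff_A add_A by (simp add: poly_of_def sum_subtractf right_diff_distrib)
  also have "\<dots> = (\<Sum>t\<in>Box. f t * (\<Sum>j<p. (\<Prod>w<n. (aff j 1 a + b) (t w)) - (\<Prod>w<n. b (t w))))"
    by (subst sum.swap) (simp only: sum_distrib_left)
  also have "\<dots> = 0" using inner by (intro sum.neutral ballI) (simp only: mult_zero_right)
  finally show "(\<Sum>j<p. poly_of Box n f (aff j 1 a + b) - poly_of Box n f b) = 0" .
qed

text \<open>In the second difference of a monomial the factors are distributed over positions \<open>Y\<close> (taken from
  \<open>a\<close>), \<open>C\<close> (from the constant vector) and the rest (from \<open>b\<close>). The sum over \<open>h\<close> of such a term depends only
  on the fibre belonging to \<open>Y\<close> and any \<open>w\<close> in \<open>C\<close>: the power of \<open>\<omega>\<close> involves the entries in \<open>Y\<close> and at \<open>w\<close>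
  through their sum modulo \<open>p\<close>, and scaling the entries in \<open>Y\<close> permutes the summands.\<close>

lemma mixed_term_invariant:
  fixes a b :: "nat \<Rightarrow> 'k" and c :: 'k and j :: nat
  assumes Y: "Y \<subseteq> {..<n}" "Y \<noteq> {}" and C: "C \<subseteq> {..<n} - Y" "w \<in> C"
    and t: "t \<in> Box" and t': "t' \<in> Box" and eq: "line_class n Y w t = line_class n Y w t'"
  defines "\<Phi> \<equiv> \<lambda>t. \<Sum>h\<in>{1..<p}. (\<Prod>i\<in>Y. aff j h a (t i)) * (\<Prod>i\<in>C. aff j h (const_vec c) (t i)) * (\<Prod>i\<in>{..<n} - Y - C. b (t i))"
  shows "\<Phi> t = \<Phi> t'"
proof -
  have fin: "finite Y" "finite C" using Y C finite_subset by blast+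
  have w: "w < n" "w \<notin> Y" using C by auto
  have \<Phi>: "\<Phi> t = \<omega> ^ (j * ((t w + (\<Sum>i\<in>Y. t i)) + (\<Sum>i\<in>C - {w}. t i))) * c ^ card C * (\<Prod>i\<in>{..<n} - Y - C. b (t i)) *
      (\<Sum>h\<in>{1..<p}. \<Prod>i\<in>Y. a (h * t i mod p))" if t: "t \<in> Box" for t
  proof -
    have "(\<Prod>i\<in>Y. aff j h a (t i)) * (\<Prod>i\<in>C. aff j h (const_vec c) (t i)) * (\<Prod>i\<in>{..<n} - Y - C. b (t i)) =
      \<omega> ^ (j * ((t w + (\<Sum>i\<in>Y. t i)) + (\<Sum>i\<in>C - {w}. t i))) * c ^ card C * (\<Prod>i\<in>{..<n} - Y - C. b (t i)) *
      (\<Prod>i\<in>Y. a (h * t i mod p))" if h: "h \<in> {1..<p}" for h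
    proof -
      have 1: "(\<Prod>i\<in>Y. aff j h a (t i)) = \<omega> ^ (j * (\<Sum>i\<in>Y. t i)) * (\<Prod>i\<in>Y. a (h * t i mod p))"
      proof -
        have "(\<Prod>i\<in>Y. aff j h a (t i)) = (\<Prod>i\<in>Y. \<omega> ^ (j * t i) * a (h * t i mod p))"
          using Y t by (intro prod.cong) (auto simp: aff_at)
        then show ?thesis by (simp add: prod.distrib power_sum sum_distrib_left)
      qed
      have 2: "(\<Prod>i\<in>C. aff j h (const_vec c) (t i)) = \<omega> ^ (j * (\<Sum>i\<in>C. t i)) * c ^ card C"
      proof -
        have "(\<Prod>i\<in>C. aff j h (const_vec c) (t i)) = (\<Prod>i\<in>C. \<omega> ^ (j * t i) * c)"
        proof (rule prod.cong[OF refl])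
          fix i assume "i \<in> C"
          then have i: "i < n" using C by auto
          have "h * t i mod p \<in> {1..<p}" using mult_mod_prime_range[OF prime_p h Box_range[OF t i]] .
          then show "aff j h (const_vec c) (t i) = \<omega> ^ (j * t i) * c"
            unfolding aff_at[OF t i] const_vec_def by (simp only: if_True)
        qed
        then show ?thesis by (simp add: prod.distrib power_sum sum_distrib_left)
      qed
      have 3: "(\<Sum>i\<in>C. t i) = t w + (\<Sum>i\<in>C - {w}. t i)" using C fin by (simp add: sum.remove)
      show ?thesis unfolding 1 2 3 by (simp add: algebra_simps power_add)
    qed
    then show ?thesis unfolding \<Phi>_def sum_distrib_left by (intro sum.cong refl)
  qed
  note D = line_class_eqD[OF Y w eq Box_range[OF t] Box_range[OF t']]
  have same: "t i = t' i" if "i \<in> {..<n} - Y - {w}" for i using D(1) that by auto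
  have e1: "\<omega> ^ (j * ((t w + (\<Sum>i\<in>Y. t i)) + (\<Sum>i\<in>C - {w}. t i))) =
     \<omega> ^ (j * ((t' w + (\<Sum>i\<in>Y. t' i)) + (\<Sum>i\<in>C - {w}. t' i)))"
  proof -
    have "(\<Sum>i\<in>C - {w}. t i) = (\<Sum>i\<in>C - {w}. t' i)" using same C by (intro sum.cong) auto
    then show ?thesis using D(2) by (intro omega_pow_cong cong_scalar_left) (simp add: cong_add_rcancel_nat)
  qed
  have e2: "(\<Prod>i\<in>{..<n} - Y - C. b (t i)) = (\<Prod>i\<in>{..<n} - Y - C. b (t' i))"
    by (intro prod.cong refl arg_cong[of _ _ b] same) (use C in auto)
  obtain g where g: "g \<in> {1..<p}" "\<forall>i\<in>Y. t' i = g * t i mod p" using D(3) by blast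
  have e3: "(\<Sum>h\<in>{1..<p}. \<Prod>i\<in>Y. a (h * t' i mod p)) = (\<Sum>h\<in>{1..<p}. \<Prod>i\<in>Y. a (h * t i mod p))"
  proof -
    have "h * t' i mod p = (g * h mod p) * t i mod p" if "i \<in> Y" for h i
      using g(2) that by (simp add: mod_mult_left_eq mod_mult_right_eq mult.assoc mult.left_commute)
    then have "(\<Sum>h\<in>{1..<p}. \<Prod>i\<in>Y. a (h * t' i mod p)) = (\<Sum>h\<in>{1..<p}. \<Prod>i\<in>Y. a ((g * h mod p) * t i mod p))"
      by simp
    also have "\<dots> = (\<Sum>h\<in>{1..<p}. \<Prod>i\<in>Y. a (h * t i mod p))"
    proof (rule sum.reindex_bij_witness[of _ "\<lambda>h. inv_scale g * h mod p" "\<lambda>h. g * h mod p"])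
      fix h assume h: "h \<in> {1..<p}"
      then show "inv_scale g * (g * h mod p) mod p = h" "g * (inv_scale g * h mod p) mod p = h"
        using inv_scale[OF g(1)]
        by (metis atLeastLessThan_iff mod_less mod_mult_left_eq mod_mult_right_eq mult.assoc mult_1)+
      show "g * h mod p \<in> {1..<p}" "inv_scale g * h mod p \<in> {1..<p}"
        using mult_mod_prime_range[OF prime_p] g h inv_scale[OF g(1)] by blast+
    qed auto
    finally show ?thesis .
  qed
  show ?thesis unfolding \<Phi>[OF t] \<Phi>[OF t'] e1 e2 e3 ..
qed

lemma poly_of_complement_sum_zero: "complement_sum_zero (poly_of Box n f)"
  unfolding complement_sum_zero_def
proof (intro ballI allI impI)
  fix j a b c assume ab: "j < p" "a \<in> A" "b \<in> A" "c \<in> S"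
  let ?P = "poly_of Box n f" and ?I = "{..<n}"
  define \<Phi> where "\<Phi> Y C t = (\<Sum>h\<in>{1..<p}. (\<Prod>i\<in>Y. aff j h a (t i)) * (\<Prod>i\<in>C. aff j h (const_vec c) (t i)) * (\<Prod>i\<in>?I - Y - C. b (t i)))" for Y C t
  let ?q = "\<lambda>h t. \<Sum>Y\<in>Pow ?I - {{}}. \<Sum>C\<in>Pow (?I - Y) - {{}}.
    (\<Prod>i\<in>Y. aff j h a (t i)) * (\<Prod>i\<in>C. aff j h (const_vec c) (t i)) * (\<Prod>i\<in>?I - Y - C. b (t i))"
  have "?P (aff j h (a + const_vec c) + b) - ?P (aff j h (const_vec c) + b) - ?P (aff j h a + b) + ?P b = (\<Sum>t\<in>Box. f t * ?q h t)" for h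
  proof -
    have "?P (aff j h (a + const_vec c) + b) - ?P (aff j h (const_vec c) + b) - ?P (aff j h a + b) + ?P b =
      (\<Sum>t\<in>Box. f t * ((\<Prod>w<n. aff j h a (t w) + aff j h (const_vec c) (t w) + b (t w)) - (\<Prod>w<n. aff j h (const_vec c) (t w) + b (t w))
        - (\<Prod>w<n. aff j h a (t w) + b (t w)) + (\<Prod>w<n. b (t w))))"
      using ab aff_A add_A const_vec_A
      by (simp add: poly_of_def aff_add sum_subtractf sum.distrib right_diff_distrib distrib_left)
    also have "\<dots> = (\<Sum>t\<in>Box. f t * ?q h t)"
      by (subst prod_second_difference) auto
    finally show ?thesis .
  qed
  then have "(\<Sum>h\<in>{1..<p}. ?P (aff j h (a + const_vec c) + b) - ?P (aff j h (const_vec c) + b) - ?P (aff j h a + b) + ?P b) =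
    (\<Sum>h\<in>{1..<p}. \<Sum>t\<in>Box. f t * ?q h t)" by simp
  also have "\<dots> = (\<Sum>t\<in>Box. f t * (\<Sum>h\<in>{1..<p}. ?q h t))"
    by (subst sum.swap) (simp only: sum_distrib_left)
  also have "\<dots> = (\<Sum>t\<in>Box. f t * (\<Sum>Y\<in>Pow ?I - {{}}. \<Sum>C\<in>Pow (?I - Y) - {{}}. \<Phi> Y C t))"
  proof -
    have "(\<Sum>h\<in>{1..<p}. ?q h t) = (\<Sum>Y\<in>Pow ?I - {{}}. \<Sum>C\<in>Pow (?I - Y) - {{}}. \<Phi> Y C t)" for t
      unfolding \<Phi>_def by (subst sum.swap, rule sum.cong[OF refl], rule sum.swap)
    then show ?thesis by simp
  qed
  also have "\<dots> = (\<Sum>Y\<in>Pow ?I - {{}}. \<Sum>C\<in>Pow (?I - Y) - {{}}. \<Sum>t\<in>Box. f t * \<Phi> Y C t)"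
  proof -
    have "(\<Sum>t\<in>Box. f t * (\<Sum>Y\<in>Pow ?I - {{}}. \<Sum>C\<in>Pow (?I - Y) - {{}}. \<Phi> Y C t)) =
      (\<Sum>t\<in>Box. \<Sum>Y\<in>Pow ?I - {{}}. \<Sum>C\<in>Pow (?I - Y) - {{}}. f t * \<Phi> Y C t)"
      by (simp only: sum_distrib_left)
    also have "\<dots> = (\<Sum>Y\<in>Pow ?I - {{}}. \<Sum>t\<in>Box. \<Sum>C\<in>Pow (?I - Y) - {{}}. f t * \<Phi> Y C t)"
      by (rule sum.swap)
    also have "\<dots> = (\<Sum>Y\<in>Pow ?I - {{}}. \<Sum>C\<in>Pow (?I - Y) - {{}}. \<Sum>t\<in>Box. f t * \<Phi> Y C t)"
      by (intro sum.cong refl sum.swap)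
    finally show ?thesis .
  qed
  also have "\<dots> = 0"
  proof (rule sum.neutral, rule ballI, rule sum.neutral, rule ballI)
    fix Y C assume Y: "Y \<in> Pow ?I - {{}}" and C: "C \<in> Pow (?I - Y) - {{}}"
    then obtain w where w: "w \<in> C" by blast
    show "(\<Sum>t\<in>Box. f t * \<Phi> Y C t) = 0"
    proof (rule sum_zero_of_fibre_sums[OF finite_Box, where \<kappa> = "line_class n Y w" and f = f and \<Phi> = "\<Phi> Y C"])
      show "(\<Sum>t\<in>{t \<in> Box. line_class n Y w t = v}. f t) = 0" for v
        using f_fibre[of Y w v] Y C w by auto
      show "\<Phi> Y C t = \<Phi> Y C t'" if "t \<in> Box" "t' \<in> Box" "line_class n Y w t = line_class n Y w t'" for t t'
        unfolding \<Phi>_def using Y C that w by (intro mixed_term_invariant) auto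
    qed
  qed
  finally show "(\<Sum>h\<in>{1..<p}. ?P (aff j h (a + const_vec c) + b) - ?P (aff j h (const_vec c) + b) - ?P (aff j h a + b) + ?P b) = 0" .
qed

lemma poly_of_M: "poly_of Box n f \<in> M (Suc n)"
proof -
  have "degree_less (Suc n) (\<lambda>x. \<Sum>t\<in>Box. f t * (\<Prod>w<n. x (t w)))"
    using degree_less_monomial[of "{..<n}"] by (intro degree_less_sum finite_Box degree_less_scale) simp
  then have "degree_less (Suc n) (poly_of Box n f)"
    using degree_less_cong[of "poly_of Box n f" "\<lambda>x. \<Sum>t\<in>Box. f t * (\<Prod>w<n. x (t w))" "Suc n"] by (simp add: poly_of_def)
  moreover have "poly_of Box n f x \<in> S" for x
  proof (cases "x \<in> A")
    case True
    have "(\<Sum>t\<in>Box. f t * (\<Prod>w<n. x (t w))) \<in> S"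
      by (intro sum_S mult_S prod_S) (auto intro: f_S A_S[OF True])
    then show ?thesis using True by (simp add: poly_of_def)
  qed (simp add: poly_of_def zero_S)
  moreover have "poly_of Box n f 0 = 0"
    using n_pos by (auto simp: poly_of_def prod_zero_iff intro!: sum.neutral)
  ultimately show ?thesis unfolding M_def using poly_of_kernel_sum_zero poly_of_complement_sum_zero by (auto simp: poly_of_def)
qed

text \<open>Commuting successively with the unit vectors of index \<open>i 0, i 1, \<dots>\<close> extracts from the polynomial, up
  to sign, the monomials that start with these indices. No index occurs at two different positions, so each
  unit vector affects one factor only.\<close>

lemma iterated_commutators:
  assumes i: "i \<in> Box" and disj: "\<And>t t' w w'. t \<in> Box \<Longrightarrow> t' \<in> Box \<Longrightarrow> w < n \<Longrightarrow> w' < n \<Longrightarrow> w \<noteq> w' \<Longrightarrow> t w \<noteq> t' w'"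
    and k: "k < n"
  shows "\<exists>Q\<in>M (Suc n). (0, Q) \<in> lower_central (G (Suc n)) k \<and>
    (\<forall>x\<in>A. Q x = (- 1) ^ k * (\<Sum>t\<in>{t \<in> Box. \<forall>w<k. t w = i w}. f t * (\<Prod>w\<in>{k..<n}. x (t w))))"
  using k
proof (induction k)
  case 0
  have "(0, poly_of Box n f) \<in> lower_central (G (Suc n)) 0"
    using poly_of_M zero_A by (simp add: carrier_G)
  moreover have "poly_of Box n f x = (- 1) ^ 0 * (\<Sum>t\<in>{t \<in> Box. \<forall>w<0. t w = i w}. f t * (\<Prod>w\<in>{0..<n}. x (t w)))"
    if "x \<in> A" for x
    using that by (simp add: poly_of_def atLeast0LessThan)
  ultimately show ?case using poly_of_M by blast
next
  case (Suc k)
  let ?Box = "\<lambda>k. {t \<in> Box. \<forall>w<k. t w = i w}"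
  let ?R = "\<lambda>k x. \<Sum>t\<in>?Box k. f t * (\<Prod>w\<in>{k..<n}. x (t w))"
  obtain Q where Q: "Q \<in> M (Suc n)" "(0, Q) \<in> lower_central (G (Suc n)) k" "\<And>x. x \<in> A \<Longrightarrow> Q x = (- 1) ^ k * ?R k x"
    using Suc.IH[OF Suc_lessD[OF Suc.prems]] by blast
  define e :: "nat \<Rightarrow> 'k" where "e = (\<lambda>x. if x = i k then 1 else 0)"
  have eA: "e \<in> A" using Box_range[OF i, of k] Suc.prems by (intro A_I) (auto simp: e_def zero_S one_S)
  have e_later: "e (t w) = 0" if "t \<in> Box" "w \<in> {Suc k..<n}" for t w
    using disj[OF that(1) i, of w k] that Suc.prems by (auto simp: e_def)
  have split: "{k..<n} = insert k {Suc k..<n}" using Suc.prems by auto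
  have Re: "?R k e = 0"
  proof (rule sum.neutral, rule ballI)
    fix t assume "t \<in> ?Box k"
    then have "e (t (Suc k)) = 0" using e_later[of t "Suc k"] Suc.prems by simp
    then have "(\<Prod>w\<in>{k..<n}. e (t w)) = 0" using Suc.prems by (intro prod_zero) auto
    then show "f t * (\<Prod>w\<in>{k..<n}. e (t w)) = 0" by simp
  qed
  have step: "?R k (x + e) - ?R k x = ?R (Suc k) x" for x
  proof -
    have "(\<Prod>w\<in>{k..<n}. (x + e) (t w)) - (\<Prod>w\<in>{k..<n}. x (t w)) = e (t k) * (\<Prod>w\<in>{Suc k..<n}. x (t w))"
      if "t \<in> Box" for t
    proof -
      have "(\<Prod>w\<in>{Suc k..<n}. (x + e) (t w)) = (\<Prod>w\<in>{Suc k..<n}. x (t w))"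
        using e_later[OF that] by (intro prod.cong) auto
      then show ?thesis unfolding split by (simp add: algebra_simps)
    qed
    then have "?R k (x + e) - ?R k x = (\<Sum>t\<in>?Box k. f t * (e (t k) * (\<Prod>w\<in>{Suc k..<n}. x (t w))))"
      unfolding sum_subtractf[symmetric] right_diff_distrib[symmetric] by (intro sum.cong) auto
    also have "\<dots> = (\<Sum>t\<in>?Box (Suc k). f t * (\<Prod>w\<in>{Suc k..<n}. x (t w)))"
      using finite_Box by (intro sum.mono_neutral_cong_right) (auto simp: e_def less_Suc_eq)
    finally show ?thesis .
  qed
  let ?Q' = "Q - translate e Q"
  have "?Q' \<in> M (Suc n)" using add_M[OF Q(1) minus_M[OF translate_M[OF Q(1) eA]]] by simp
  moreover have "(0, ?Q') \<in> lower_central (G (Suc n)) (Suc k)"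
  proof -
    have "(e, 0) \<in> carrier (G (Suc n))" using eA zero_M by (simp add: carrier_G)
    then have "(0, Q) \<otimes>\<^bsub>G (Suc n)\<^esub> (e, 0) \<otimes>\<^bsub>G (Suc n)\<^esub> inv\<^bsub>G (Suc n)\<^esub> (0, Q) \<otimes>\<^bsub>G (Suc n)\<^esub> inv\<^bsub>G (Suc n)\<^esub> (e, 0)
       \<in> lower_central (G (Suc n)) (Suc k)"
      using Q(2) by (auto simp: commutator_subgroup_def intro!: generate.incl)
    then show ?thesis unfolding commutator_G[OF Q(1) eA zero_M] .
  qed
  moreover have "?Q' x = (- 1) ^ Suc k * ?R (Suc k) x" if x: "x \<in> A" for x
  proof -
    have "?Q' x = - (Q (x + e) - Q x - Q e)" using x by (simp add: translate_def)
    also have "\<dots> = - ((- 1) ^ k * (?R k (x + e) - ?R k x))"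
      using Q(3)[OF x] Q(3)[OF eA] Q(3)[OF add_A[OF x eA]] Re by (simp add: right_diff_distrib)
    finally show ?thesis unfolding step by simp
  qed
  ultimately show ?case by blast
qed

lemma class_bound:
  assumes i: "i \<in> Box" "f i \<noteq> 0"
    and disj: "\<And>t t' w w'. t \<in> Box \<Longrightarrow> t' \<in> Box \<Longrightarrow> w < n \<Longrightarrow> w' < n \<Longrightarrow> w \<noteq> w' \<Longrightarrow> t w \<noteq> t' w'"
    and ext: "\<And>t t'. t \<in> Box \<Longrightarrow> t' \<in> Box \<Longrightarrow> (\<And>w. w < n \<Longrightarrow> t w = t' w) \<Longrightarrow> t = t'"
  shows "n \<le> nilpotency_class (G (Suc n))"
proof -
  let ?k = "n - 1"
  have k: "?k < n" "Suc ?k = n" using n_pos by auto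
  obtain Q where Q: "Q \<in> M (Suc n)" "(0, Q) \<in> lower_central (G (Suc n)) ?k"
    "\<And>x. x \<in> A \<Longrightarrow> Q x = (- 1) ^ ?k * (\<Sum>t\<in>{t \<in> Box. \<forall>w<?k. t w = i w}. f t * (\<Prod>w\<in>{?k..<n}. x (t w)))"
    using iterated_commutators[of i ?k] i(1) disj k(1) by blast
  define e :: "nat \<Rightarrow> 'k" where "e = (\<lambda>x. if x = i ?k then 1 else 0)"
  have eA: "e \<in> A" using Box_range[OF i(1) k(1)] by (intro A_I) (auto simp: e_def zero_S one_S)
  have single: "{?k..<n} = {?k}" using k by auto
  have "(\<Sum>t\<in>{t \<in> Box. \<forall>w<?k. t w = i w}. f t * (\<Prod>w\<in>{?k..<n}. e (t w))) = (\<Sum>t\<in>{i}. f t)"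
  proof (rule sum.mono_neutral_cong_right)
    show "\<forall>t\<in>{t \<in> Box. \<forall>w<?k. t w = i w} - {i}. f t * (\<Prod>w\<in>{?k..<n}. e (t w)) = 0"
    proof
      fix t assume t: "t \<in> {t \<in> Box. \<forall>w<?k. t w = i w} - {i}"
      have "t ?k \<noteq> i ?k"
      proof
        assume eq: "t ?k = i ?k"
        have "t w = i w" if "w < n" for w
          using t eq that k by (cases "w = ?k") auto
        then have "t = i" using ext[of t i] t i by blast
        then show False using t by simp
      qed
      then show "f t * (\<Prod>w\<in>{?k..<n}. e (t w)) = 0" unfolding single by (simp add: e_def)
    qed
    show "f t * (\<Prod>w\<in>{?k..<n}. e (t w)) = f t" if "t \<in> {i}" for t
      using that unfolding single by (simp add: e_def)
  qed (use i finite_Box in auto)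
  then have "Q e \<noteq> 0" using Q(3)[OF eA] i(2) by simp
  then have "Q \<noteq> 0" by auto
  then have "lower_central (G (Suc n)) ?k \<noteq> {\<one>\<^bsub>G (Suc n)\<^esub>}" using Q(2) by (auto simp: one_G)
  from nilpotency_class_greater[OF nilpotent_G this] show ?thesis using k by linarith
qed

end

end

section \<open>Choice of the parameters\<close>

lemma (in coefficient_field) large_class:
  assumes n: "0 < n" and nB: "n * (n * B) < p" and count: "2 ^ n * n * p ^ (n - 1) < B ^ n"
  shows "n \<le> nilpotency_class (G (Suc n))"
proof -
  \<comment> \<open>Disjoint ranges of length \<open>B\<close> for the different positions.\<close>
  define Box where "Box = (\<Pi>\<^sub>E w\<in>{..<n}. {w * B + 1..(w + 1) * B})"
  define J where "J = {(Y, w). Y \<subseteq> {..<n} \<and> Y \<noteq> {} \<and> w < n \<and> w \<notin> Y}"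
  have fin_Box: "finite Box" unfolding Box_def by (intro finite_PiE) auto
  have card_Box: "card Box = B ^ n" unfolding Box_def by (subst card_PiE) auto
  have J_sub: "J \<subseteq> Pow {..<n} \<times> {..<n}" by (auto simp: J_def)
  have finJ: "finite J" using J_sub by (rule finite_subset) auto
  have cJ: "card J \<le> 2 ^ n * n"
    using card_mono[OF _ J_sub] by (simp add: card_cartesian_product card_Pow)
  have tw: "t w \<in> {w * B + 1..(w + 1) * B}" if "t \<in> Box" "w < n" for t w
    using that by (auto simp: Box_def PiE_iff)
  have tw_le: "t w \<le> n * B" if "t \<in> Box" "w < n" for t w
  proof -
    have "(w + 1) * B \<le> n * B" using that by (intro mult_le_mono) auto
    then show ?thesis using tw[OF that] by simp
  qed
  have t_range: "t w \<in> {1..<p}" if "t \<in> Box" "w < n" for t w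
  proof -
    have "n * B \<le> n * (n * B)" using n by simp
    then have "t w < p" using tw_le[OF that] nB by linarith
    then show ?thesis using tw[OF that] by simp
  qed
  have ts: "(\<Sum>i<n. t i) < p" if "t \<in> Box" for t
  proof -
    have "(\<Sum>i<n. t i) \<le> of_nat (card {..<n}) * (n * B)" using tw_le[OF that] by (intro sum_bounded_above) auto
    then show ?thesis using nB by simp
  qed
  have disj: "t w \<noteq> t' w'" if "t \<in> Box" "t' \<in> Box" "w < n" "w' < n" "w \<noteq> w'" for t t' w w'
  proof -
    have *: "t w < t' w'" if "t \<in> Box" "t' \<in> Box" "w < w'" "w' < n" for t t' w w'
    proof -
      have "(w + 1) * B \<le> w' * B" using that by (intro mult_le_mono) auto
      then show ?thesis using tw[of t w] tw[of t' w'] that by simp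
    qed
    show ?thesis using *[of t t' w w'] *[of t' t w' w] that by (metis less_irrefl linorder_neqE_nat)
  qed
  have ext: "t = t'" if "t \<in> Box" "t' \<in> Box" "\<And>w. w < n \<Longrightarrow> t w = t' w" for t t'
    using that unfolding Box_def by (intro PiE_ext[of t "{..<n}" _ t']) auto
  have fibres: "card ((\<lambda>t. case j of (Y, w) \<Rightarrow> line_class n Y w t) ` Box) \<le> p ^ (n - 1)" if j: "j \<in> J" for j
  proof -
    obtain Y w where Yw: "j = (Y, w)" "Y \<subseteq> {..<n}" "Y \<noteq> {}" using j by (auto simp: J_def)
    have y0: "Min Y \<in> {..<n}" using Yw Min_in[of Y] finite_subset by blast
    let ?T = "\<Pi>\<^sub>E i\<in>{..<n}. if i = Min Y then {0} else {..<p}"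
    have "line_class n Y w t \<in> ?T" if "t \<in> Box" for t
      using t_range[OF that] p_pos by (auto simp: line_class_def)
    then have "line_class n Y w ` Box \<subseteq> ?T" by blast
    then have "card (line_class n Y w ` Box) \<le> card ?T" by (intro card_mono finite_PiE) auto
    also have "\<dots> = (\<Prod>i\<in>{..<n}. if i = Min Y then 1 else p)"
      by (subst card_PiE) (auto intro!: prod.cong)
    also have "\<dots> = p ^ (n - 1)"
    proof -
      have "(\<Prod>i\<in>{..<n} - {Min Y}. if i = Min Y then 1 else p) = (\<Prod>i\<in>{..<n} - {Min Y}. p)"
        by (intro prod.cong) auto
      then show ?thesis using y0 by (subst prod.remove[OF _ y0]) simp_all
    qed
    finally show ?thesis using Yw by simp
  qed
  have "(\<Sum>j\<in>J. card ((\<lambda>t. case j of (Y, w) \<Rightarrow> line_class n Y w t) ` Box)) \<le> of_nat (card J) * p ^ (n - 1)"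
    using fibres by (intro sum_bounded_above) auto
  also have "\<dots> \<le> 2 ^ n * n * p ^ (n - 1)" using cJ by (simp add: mult_le_mono1)
  also have "\<dots> < card Box" using count card_Box by simp
  finally have card: "(\<Sum>j\<in>J. card ((\<lambda>t. case j of (Y, w) \<Rightarrow> line_class n Y w t) ` Box)) < card Box" .
  obtain f where f: "\<forall>t\<in>Box. f t \<in> S" "\<exists>t\<in>Box. f t \<noteq> 0"
    "\<forall>j\<in>J. \<forall>v. (\<Sum>t\<in>{t \<in> Box. (case j of (Y, w) \<Rightarrow> line_class n Y w t) = v}. f t) = 0"
    using zero_fibre_sums_exist[OF fin_Box finJ finite_S zero_S one_S one_neq_zero add_S minus_S card] by blast
  obtain i where i: "i \<in> Box" "f i \<noteq> 0" using f(2) by blast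
  have fib: "(\<Sum>t\<in>{t \<in> Box. line_class n Y w t = v}. f t) = 0"
    if "Y \<subseteq> {..<n}" "Y \<noteq> {}" "w < n" "w \<notin> Y" for Y w v
  proof -
    have "(Y, w) \<in> J" using that by (simp add: J_def)
    with f(3) show ?thesis by fastforce
  qed
  show ?thesis
  proof (rule class_bound[where Box = Box and f = f and i = i])
    show "\<And>t i. t \<in> Box \<Longrightarrow> i < n \<Longrightarrow> t i \<in> {1..<p}" by (rule t_range)
    show "\<And>t. t \<in> Box \<Longrightarrow> f t \<in> S" using f(1) by blast
    show "\<And>Y w v. Y \<subseteq> {..<n} \<Longrightarrow> Y \<noteq> {} \<Longrightarrow> w < n \<Longrightarrow> w \<notin> Y \<Longrightarrow>
      (\<Sum>t\<in>{t \<in> Box. line_class n Y w t = v}. f t) = 0" by (rule fib)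
    show "\<And>t t' w w'. t \<in> Box \<Longrightarrow> t' \<in> Box \<Longrightarrow> w < n \<Longrightarrow> w' < n \<Longrightarrow> w \<noteq> w' \<Longrightarrow> t w \<noteq> t' w'" by (rule disj)
    show "\<And>t t'. t \<in> Box \<Longrightarrow> t' \<in> Box \<Longrightarrow> (\<And>w. w < n \<Longrightarrow> t w = t' w) \<Longrightarrow> t = t'" by (rule ext)
  qed (use n fin_Box ts i in auto)
qed

text \<open>With \<open>B\<close> about \<open>p / n\<^sup>2\<close>, the power \<open>B ^ n\<close> exceeds any given multiple of \<open>p ^ (n - 1)\<close> once \<open>p\<close>
  is large.\<close>

lemma parameters_exist:
  assumes n: "0 < n"
  obtains p B :: nat where "prime p" "2 < p" "n * (n * B) < p" "2 ^ n * n * p ^ (n - 1) < B ^ n"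
proof -
  define K where "K = 2 ^ n * n * (2 * n * n) ^ (n - 1)"
  obtain p where p: "prime p" "n * n * (K + 1) + 2 < p" using bigger_prime by blast
  define B where "B = (p - 1) div (n * n)"
  have nn: "0 < n * n" using n by simp
  have "K + 1 \<le> B" unfolding B_def using p nn by (simp add: less_eq_div_iff_mult_less_eq mult.commute)
  then have B: "K < B" "1 \<le> B" by auto
  have "B * (n * n) \<le> p - 1" unfolding B_def by (rule div_times_less_eq_dividend)
  then have 1: "n * (n * B) < p" using p by (simp add: mult_ac)
  have "p - 1 = n * n * B + (p - 1) mod (n * n)" unfolding B_def by simp
  then have "p - 1 < n * n * B + n * n" using mod_less_divisor[OF nn, of "p - 1"] by linarith
  then have "p \<le> n * n * B + n * n" by linarith
  also have "\<dots> \<le> 2 * n * n * B" using B by (simp add: mult_2 flip: mult_2 distrib_left) 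
  finally have "p ^ (n - 1) \<le> (2 * n * n * B) ^ (n - 1)" by (rule power_mono) simp
  then have "2 ^ n * n * p ^ (n - 1) \<le> 2 ^ n * n * ((2 * n * n) ^ (n - 1) * B ^ (n - 1))"
    by (simp add: power_mult_distrib)
  also have "\<dots> = K * B ^ (n - 1)" by (simp add: K_def)
  also have "\<dots> < B * B ^ (n - 1)" using B by simp
  also have "\<dots> = B ^ n" using n by (metis power_eq_if not_gr_zero)
  finally show thesis using that p 1 by auto
qed

text \<open>The finite field of order \<open>2 ^ (p - 1)\<close> inside the algebraic closure of the field with two elements;
  it contains the \<open>p\<close>-th roots of unity since \<open>p\<close> divides \<open>2 ^ (p - 1) - 1\<close>.\<close>

lemma coefficient_field_exists:
  assumes p: "prime p" "2 < p"
  shows "\<exists>(S :: bit alg_closure set) \<omega>. coefficient_field S \<omega> p"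
proof -
  have two: "x + x = 0" for x :: "bit alg_closure"
  proof -
    have "(1 :: bit alg_closure) + 1 = to_ac (1 + 1 :: bit)" by (simp only: to_ac_add to_ac_1)
    also have "\<dots> = 0" by simp
    finally have "(1 + 1) * x = 0" by simp
    then show ?thesis by (simp only: distrib_right mult_1)
  qed
  have neg: "- x = x" for x :: "bit alg_closure"
    using two[of x] by (simp add: eq_neg_iff_add_eq_0 minus_unique)
  define \<Phi> :: "bit alg_closure poly" where "\<Phi> = (\<Sum>j<p. monom 1 j)"
  have coeff: "coeff \<Phi> i = (if i < p then 1 else 0)" for i
    by (auto simp: \<Phi>_def coeff_sum if_distrib sum.delta cong: if_cong)
  have "p - 1 \<le> degree \<Phi>" using p by (intro le_degree) (simp add: coeff)
  then have "0 < degree \<Phi>" using p by simp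
  then obtain \<omega> where root: "poly \<Phi> \<omega> = 0" using alg_closed_imp_poly_has_root by blast
  have "poly \<Phi> \<omega> = (\<Sum>j<p. \<omega> ^ j)" by (simp add: \<Phi>_def poly_sum poly_monom)
  then have sum0: "(\<Sum>j<p. \<omega> ^ j) = 0" using root by simp
  have "\<omega> ^ p - 1 = (\<omega> - 1) * (\<Sum>j<p. \<omega> ^ j)" by (simp add: power_diff_1_eq)
  then have wp: "\<omega> ^ p = 1" using sum0 by simp
  have "odd p" using p prime_odd_nat by blast
  then obtain m where m: "p = m + m + 1" by (metis oddE mult_2)
  have p1: "of_nat p = (1 :: bit alg_closure)" by (simp add: m two)
  have w1: "\<omega> \<noteq> 1" using sum0 p1 by auto
  define N where "N = p - 1"
  define S :: "bit alg_closure set" where "S = {x. x ^ (2 ^ N) = x}"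
  have frob: "(x + y) ^ (2 ^ k) = x ^ (2 ^ k) + y ^ (2 ^ k)" for x y :: "bit alg_closure" and k
  proof (induction k)
    case (Suc k)
    have "(x + y) ^ (2 ^ Suc k) = ((x + y) ^ (2 ^ k))\<^sup>2" by (simp add: mult.commute flip: power_mult)
    also have "\<dots> = (x ^ (2 ^ k) + y ^ (2 ^ k))\<^sup>2" using Suc by simp
    also have "\<dots> = (x ^ (2 ^ k))\<^sup>2 + (y ^ (2 ^ k))\<^sup>2 + (x ^ (2 ^ k) * y ^ (2 ^ k) + x ^ (2 ^ k) * y ^ (2 ^ k))"
      by (simp add: power2_eq_square algebra_simps)
    also have "\<dots> = x ^ (2 ^ Suc k) + y ^ (2 ^ Suc k)" by (simp add: two mult.commute flip: power_mult)
    finally show ?case .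
  qed simp
  have "finite S"
  proof -
    let ?q = "monom 1 (2 ^ N) - monom 1 1 :: bit alg_closure poly"
    have "0 < N" using p by (simp add: N_def)
    then have "coeff ?q 1 = - 1" by simp
    then have "?q \<noteq> 0" by (metis coeff_0 neg_equal_0_iff_equal one_neq_zero)
    then have "finite {x. poly ?q x = 0}" by (rule poly_roots_finite)
    then show ?thesis by (simp add: S_def poly_monom)
  qed
  moreover have "\<omega> \<in> S"
  proof -
    have "\<not> p dvd 2" using p by (auto dest: dvd_imp_le)
    from fermat_theorem[OF p(1) this] have "(2::nat) ^ N mod p = 1" using p by (simp add: N_def cong_def)
    then obtain q where "(2::nat) ^ N = p * q + 1" by (metis mult_div_mod_eq)
    then have "\<omega> ^ (2 ^ N) = \<omega>" by (simp add: power_add power_mult wp)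
    then show ?thesis by (simp add: S_def)
  qed
  moreover have "x + y \<in> S" "x * y \<in> S" "- x \<in> S" if "x \<in> S" "y \<in> S" for x y
    using that by (simp_all add: S_def frob power_mult_distrib neg)
  moreover have "0 \<in> S" "1 \<in> S" by (simp_all add: S_def)
  ultimately have "coefficient_field S \<omega> p"
    using p wp w1 p1 by unfold_locales auto
  then show ?thesis by blast
qed

lemma frobenius_example:
  "\<exists>N :: nat monoid. finite (carrier N) \<and> nilpotent_group N \<and> n \<le> nilpotency_class N \<and>
    (\<exists>A F H. subgroup A (AutoGroup N) \<and>
      frobenius_group ((AutoGroup N)\<lparr>carrier := A\<rparr>) F H \<and>
      metacyclic_group ((AutoGroup N)\<lparr>carrier := A\<rparr>) \<and>
      fixed_points N F = {\<one>\<^bsub>N\<^esub>} \<and>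
      comm_group (N\<lparr>carrier := fixed_points N H\<rparr>))"
proof -
  obtain p B where pB: "prime p" "2 < p" "Suc n * (Suc n * B) < p" "2 ^ Suc n * Suc n * p ^ (Suc n - 1) < B ^ Suc n"
    using parameters_exist[of "Suc n"] by blast
  obtain S :: "bit alg_closure set" and \<omega> where "coefficient_field S \<omega> p"
    using coefficient_field_exists[OF pB(1,2)] by blast
  then interpret coefficient_field S \<omega> p .
  let ?G = "G (Suc (Suc n))" and ?C = "carrier (G (Suc (Suc n)))"
  have class_ge: "Suc n \<le> nilpotency_class ?G" using large_class[OF _ pB(3,4)] by simp
  obtain N :: "nat monoid" and e where N: "group N" and e: "e \<in> iso ?G N"
    using nat_copy[OF group_G finite_G] by blast
  let ?d = "inv_into ?C e"
  have bij: "bij_betw e ?C (carrier N)" and hom: "e \<in> hom ?G N" using e by (auto simp: iso_def)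
  interpret e: group_hom ?G N e
    using group_G N hom by (simp add: group_hom_def group_hom_axioms_def)
  have lc: "lower_central N k = e ` lower_central ?G k" "lower_central ?G k \<subseteq> ?C" for k
    using e.lower_central_image bij by (auto simp: bij_betw_def)
  have triv: "lower_central N k = {\<one>\<^bsub>N\<^esub>} \<longleftrightarrow> lower_central ?G k = {\<one>\<^bsub>?G\<^esub>}" for k
  proof -
    have "e ` lower_central ?G k = e ` {\<one>\<^bsub>?G\<^esub>} \<longleftrightarrow> lower_central ?G k = {\<one>\<^bsub>?G\<^esub>}"
      using bij lc(2) by (intro inj_on_image_eq_iff[of e ?C]) (auto simp: bij_betw_def)
    then show ?thesis unfolding lc(1) by simp
  qed
  have nil: "nilpotent_group N" using nilpotent_G[of "Suc (Suc n)"] N triv unfolding nilpotent_group_def by simp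
  have cl: "nilpotency_class N = nilpotency_class ?G" unfolding nilpotency_class_def triv ..
  let ?act = "\<lambda>j h y. e (act j h (?d y))"
  have aff: "affine_action p N ?act" by (rule affine_action_iso[OF group_G N e act_affine])
  have d: "?d y \<in> ?C" "e (?d y) = y" if "y \<in> carrier N" for y
    using that bij by (auto simp: bij_betw_def inv_into_into f_inv_into_f)
  have transfer: "act j h (?d y) = ?d y" if "y \<in> carrier N" "j < p" "h \<in> {1..<p}" "?act j h y = y" for j h y
  proof -
    have "act j h (?d y) \<in> ?C" using act_hom[OF that(2,3)] d(1)[OF that(1)] by (auto simp: hom_def)
    then have "?d (?act j h y) = act j h (?d y)" using bij by (simp add: bij_betw_def)
    then show ?thesis using that(4) by simp
  qed
  have "\<exists>A F H. subgroup A (AutoGroup N) \<and>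
      frobenius_group ((AutoGroup N)\<lparr>carrier := A\<rparr>) F H \<and>
      metacyclic_group ((AutoGroup N)\<lparr>carrier := A\<rparr>) \<and>
      fixed_points N F = {\<one>\<^bsub>N\<^esub>} \<and>
      comm_group (N\<lparr>carrier := fixed_points N H\<rparr>)"
  proof (rule affine_action_frobenius[OF N prime_p p_gt_2 aff])
    fix y assume y: "y \<in> carrier N" "\<forall>j<p. ?act j 1 y = y"
    have "(1::nat) \<in> {1..<p}" using p_pos by simp
    then have "?d y = \<one>\<^bsub>?G\<^esub>" using y transfer d by (intro F_fixed) blast+
    then have "e (?d y) = \<one>\<^bsub>N\<^esub>" by simp
    then show "y = \<one>\<^bsub>N\<^esub>" using d y by simp
  next
    fix x y assume xy: "x \<in> carrier N" "y \<in> carrier N" "\<forall>h\<in>{1..<p}. ?act 0 h x = x" "\<forall>h\<in>{1..<p}. ?act 0 h y = y"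
    then have "?d x \<otimes>\<^bsub>?G\<^esub> ?d y = ?d y \<otimes>\<^bsub>?G\<^esub> ?d x"
      using transfer d p_pos by (intro H_fixed_commute) blast+
    then have "e (?d x \<otimes>\<^bsub>?G\<^esub> ?d y) = e (?d y \<otimes>\<^bsub>?G\<^esub> ?d x)" by simp
    then show "x \<otimes>\<^bsub>N\<^esub> y = y \<otimes>\<^bsub>N\<^esub> x" using d xy by simp
  qed
  moreover have "finite (carrier N)" using bij finite_G bij_betw_finite by blast
  ultimately show ?thesis using nil cl class_ge by (intro exI[of _ N]) simp
qed

theorem theorem1:
  shows "\<exists>\<GG> :: nat monoid set.
    (\<forall>G\<in>\<GG>. finite (carrier G) \<and> nilpotent_group G) \<and>
    (\<forall>n. \<exists>G\<in>\<GG>. n \<le> nilpotency_class G) \<and>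
    (\<forall>G\<in>\<GG>. \<exists>A F H.
      subgroup A (AutoGroup G) \<and>
      frobenius_group ((AutoGroup G)\<lparr>carrier := A\<rparr>) F H \<and>
      metacyclic_group ((AutoGroup G)\<lparr>carrier := A\<rparr>) \<and>
      fixed_points G F = {\<one>\<^bsub>G\<^esub>} \<and>
      comm_group (G\<lparr>carrier := fixed_points G H\<rparr>))"
proof -
  from frobenius_example obtain N :: "nat \<Rightarrow> nat monoid" where
    N: "\<And>n. finite (carrier (N n)) \<and> nilpotent_group (N n) \<and> n \<le> nilpotency_class (N n) \<and>
    (\<exists>A F H. subgroup A (AutoGroup (N n)) \<and>
      frobenius_group ((AutoGroup (N n))\<lparr>carrier := A\<rparr>) F H \<and>
      metacyclic_group ((AutoGroup (N n))\<lparr>carrier := A\<rparr>) \<and>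
      fixed_points (N n) F = {\<one>\<^bsub>N n\<^esub>} \<and>
      comm_group ((N n)\<lparr>carrier := fixed_points (N n) H\<rparr>))"
    by metis
  then show ?thesis by (intro exI[of _ "range N"]) (auto; blast)
qed

end
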